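(* Let $0<x<1$, $-\tfrac12\le\theta\le\tfrac12$ be real and let $N$ be a positive integer. Put $f(t)=\exp(\pi i x t^2+2\pi i\theta t)$ and $\xi=Nx+\theta$, let $M$ be the nearest integer to $\xi$, and put $\epsilon=\xi-M$, where $M$ is chosen so that $-\tfrac12<\epsilon\le\tfrac12$. Suppose $M\ge 0$ and let $n\ge 1$ be an integer. Then $$S_N(x,\theta)-\frac{e^{-\pi i\theta^2/x+\pi i/4}}{\sqrt{x}}\,S_M\!\left(-\frac1x,\frac{\theta}{x}\right)-\frac12\bigl(f(N)-1\bigr)-\frac{e^{\pi i/4}}{2\sqrt{x}}\bigl\{E(\theta)-f(N)E(\epsilon)\bigr\}=\frac{1}{2\pi i}\sum_{r=0}^{n-1}\frac{\Gamma(r+\frac12)}{\Gamma(\frac12)}\left(\frac{x}{\pi i}\right)^{r}C_r+R_n,$$ where $$E(t)=e^{-\pi i t^2/x}\,\mathrm{erfc}\!\left(e^{-\pi i/4}\,t\sqrt{\pi/x}\right),\qquad C_r=f(N)\,\Delta_r^-(\epsilon)-\Delta_r^-(\theta)\quad(r\ge 0),$$ and the remainder $R_n$ satisfies $$|R_n|\le\frac{(\frac12)_n}{2\pi}\left(\frac{x}{\pi}\right)^{n}\bigl(\Delta_n^+(\epsilon)+\Delta_n^+(\theta)\bigr).$$ (This gives an asymptotic expansion of $S_N(x,\theta)$ as $x\to0$ and $N\to\infty$ such that $Nx$ is finite.)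
   Context: For real $y\ne 0$, real $\phi$ and integer $m\ge 0$, the generalised quadratic Gauss sum is $$S_m(y,\phi)=\sum_{j=1}^{m}\exp(\pi i y j^2+2\pi i j\phi),$$ with $S_0(y,\phi)=0$ (empty sum). In particular $S_N(x,\theta)=\sum_{j=1}^N f(j)$. $\mathrm{erfc}$ is the complementary error function, extended as an entire function: $\mathrm{erfc}(z)=1-\frac{2}{\sqrt\pi}\int_0^z e^{-u^2}\,du$. $(a)_n=\Gamma(a+n)/\Gamma(a)$ is the Pochhammer symbol. $\zeta(s,a)=\sum_{k=0}^\infty (k+a)^{-s}$ (for $\Re(s)>1$, $a>0$) is the Hurwitz zeta function. For real $\lambda$ with $|\lambda|<1$ define $$\Delta_r^+(\lambda)=\zeta(2r+1,1+\lambda)+\zeta(2r+1,1-\lambda)\qquad(r\ge1),$$ $$\Delta_0^-(\lambda)=\pi\cot(\pi\lambda)-\lambda^{-1},\qquad \Delta_r^-(\lambda)=\zeta(2r+1,1+\lambda)-\zeta(2r+1,1-\lambda)\qquad(r\ge1),$$ where $\Delta_0^-$ has a removable singularity at $\lambda=0$ and $\Delta_0^-(0)=0$. *)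

theory Defs
  imports "HOL-Complex_Analysis.Complex_Analysis"
begin

definition gauss_sum :: "nat \<Rightarrow> real \<Rightarrow> real \<Rightarrow> complex" where
  "gauss_sum m y \<phi> = (\<Sum>j=1..m. exp (pi * \<i> * y * (of_nat j)^2 + 2 * pi * \<i> * of_nat j * \<phi>))"

definition erfc :: "complex \<Rightarrow> complex" where
  "erfc z = 1 - 2 / complex_of_real (sqrt pi) *
      contour_integral (linepath 0 z) (\<lambda>u. exp (- (u^2)))"

(* The class ln provides powr, so this covers real as well as complex s.
   The value is meaningful for a > 0 and Re s > 1 only. *)
definition hurwitz_zeta :: "'a::{ln,real_normed_field} \<Rightarrow> real \<Rightarrow> 'a" where
  "hurwitz_zeta s a = (\<Sum>k. of_real (of_nat k + a) powr (- s))"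

(* Meaningful for r >= 1 only: at r = 0 the series diverge. *)
definition Delta_plus :: "nat \<Rightarrow> real \<Rightarrow> real" where
  "Delta_plus r a = hurwitz_zeta (2 * real r + 1) (1 + a) + hurwitz_zeta (2 * real r + 1) (1 - a)"

definition Delta_minus :: "nat \<Rightarrow> real \<Rightarrow> real" where
  "Delta_minus r a =
     (if r = 0 then (if a = 0 then 0 else pi * cot (pi * a) - 1 / a)
      else hurwitz_zeta (2 * real r + 1) (1 + a) - hurwitz_zeta (2 * real r + 1) (1 - a))"

end

theory Submission
  imports Defs "HOL-Probability.Distributions" "HOL-Real_Asymp.Real_Asymp"
begin

text \<open>
  By Poisson summation on each unit interval, \<open>S\<^sub>N(x,\<theta>) - (f(N) - 1)/2\<close> is the symmetric limit of
  \<open>\<Sum>\<^sub>k \<integral>\<^sub>0\<^sup>N f(t) exp (-2\<pi>ikt) dt\<close>. Completing the square, the \<open>k\<close>-th integral is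
  \<open>c (E(\<theta> - k) - f(N) E(\<xi> - k))\<close> with \<open>c = exp (\<pi>i/4) / (2\<surd>x)\<close>. The reflection
  \<open>E(-t) = 2 exp (-\<pi>it\<^sup>2/x) - E(t)\<close> makes all arguments with \<open>k \<noteq> 0\<close> (respectively \<open>k \<noteq> M\<close>)
  positive; the Gaussian terms this creates cancel for \<open>k > M\<close>, and those with \<open>1 \<le> k \<le> M\<close> form the
  second Gauss sum. What remains are the series \<open>\<Sum>\<^sub>j (E(j + a) - E(j - a))\<close> for
  \<open>a = \<theta>, \<epsilon>\<close>, into which the asymptotic expansion of \<open>erfc\<close> on the ray \<open>arg z = -\<pi>/4\<close> is
  substituted; there its remainder is at most the first omitted term.
\<close>

subsection \<open>Pointwise convergence of Fourier series\<close>

text \<open>The closed form of the Dirichlet kernel, kept free of division so that integer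
  \<open>t\<close>, where the sine vanishes, is no exception. With
  \<open>q = exp (\<i> * of_real (pi * t))\<close> the factor \<open>q - inverse q\<close> makes the
  sum telescope as \<open>K\<close> grows.\<close>

lemma sin_mult_sum_exp:
  "sin (of_real (pi * t)) * (\<Sum>k=-int K..int K. exp (- (2 * pi * \<i> * of_int k * t)))
   = (sin (of_real (real (2 * K + 1) * pi * t)) :: complex)"
proof -
  define q where "q = exp (\<i> * of_real (pi * t))"
  have q0: "q \<noteq> 0" by (simp add: q_def)
  have iv: "inverse q = exp (- (\<i> * of_real (pi * t)))"
    by (simp add: q_def exp_minus)
  have e: "exp (- (2 * pi * \<i> * of_int k * t)) = (inverse q) powi (2 * k)" for k
    unfolding iv exp_power_int by (simp add: algebra_simps)
  have s: "sin (of_real (real m * pi * t)) = (q ^ m - inverse q ^ m) / (2 * \<i>)" for m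
    unfolding sin_exp_eq q_def power_inverse exp_of_nat_mult[symmetric] exp_minus
    by (simp add: algebra_simps flip: exp_minus)
  have s1: "sin (of_real (pi * t)) = (q - inverse q) / (2 * \<i>)"
    using s[of 1] by simp
  have "(q - inverse q) * (\<Sum>k=-int K..int K. (inverse q) powi (2 * k)) = q ^ (2*K+1) - inverse q ^ (2*K+1)"
  proof (induction K)
    case 0
    then show ?case by simp
  next
    case (Suc K)
    have "{- int (Suc K)..int (Suc K)} = insert (- int (Suc K)) (insert (int (Suc K)) {-int K..int K})"
      by auto
    then have "(\<Sum>k=-int (Suc K)..int (Suc K). (inverse q) powi (2 * k)) =
        inverse q powi (- (2 * int (Suc K))) + (inverse q powi (2 * int (Suc K)) +
       (\<Sum>k=-int K..int K. (inverse q) powi (2 * k)))"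
      by (simp add: algebra_simps)
    moreover have "inverse q powi (2 * int (Suc K)) = inverse q ^ (2*K+2)"
      using power_int_of_nat[of "inverse q" "2*K+2"] by (simp add: algebra_simps)
    moreover have "inverse q powi (- (2 * int (Suc K))) = q ^ (2*K+2)"
      unfolding power_int_minus calculation(2) by (simp add: power_inverse)
    ultimately show ?case using Suc q0
      by (simp add: ring_distribs) (simp add: field_simps)
  qed
  then show ?thesis unfolding e s1 using s[of "2*K+1"] 
    by (simp only: times_divide_eq_left)
qed

text \<open>The linear interpolant is removed because \<open>sin (\<pi>z)\<close> vanishes at both endpoints; the quotient
  against the Dirichlet kernel is then smooth and the Riemann-Lebesgue lemma applies.\<close>

lemma holomorphic_div_sin_on_unit:
  assumes "g holomorphic_on UNIV"
  obtains q where "q holomorphic_on ball (1/2) 1"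
    "\<And>z. z \<in> ball (1/2) 1 \<Longrightarrow> g z = g 0 + (g 1 - g 0) * z + sin (of_real pi * z) * q z"
proof -
  \<comment> \<open>One zero is divided out at a time; each difference quotient is entire because
    its singularity is removable. The fact serves twice: for \<open>g\<close> minus its interpolant
    and for the sine.\<close>
  have fac: "\<exists>u. u holomorphic_on UNIV \<and> (\<forall>z. h z = z * (z - 1) * u z)"
    if h: "h holomorphic_on UNIV" "h 0 = 0" "h 1 = 0" for h :: "complex \<Rightarrow> complex"
  proof -
    define u1 where "u1 = (\<lambda>z. if z = 0 then deriv h 0 else (h z - h 0) / (z - 0))"
    have u1: "u1 holomorphic_on UNIV" unfolding u1_def
      by (rule pole_lemma_open) (use h in auto)
    define u2 where "u2 = (\<lambda>z. if z = 1 then deriv u1 1 else (u1 z - u1 1) / (z - 1))"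
    have u2: "u2 holomorphic_on UNIV" unfolding u2_def
      by (rule pole_lemma_open) (use u1 in auto)
    have "h z = z * (z - 1) * u2 z" for z
    proof -
      have "h z = z * u1 z" "u1 1 = 0" using h by (auto simp: u1_def)
      moreover have "u1 z = (z - 1) * u2 z" using \<open>u1 1 = 0\<close> by (auto simp: u2_def)
      ultimately show ?thesis by simp
    qed
    then show ?thesis using u2 by blast
  qed
  obtain u where u: "u holomorphic_on UNIV" "\<And>z. g z - g 0 - (g 1 - g 0) * z = z * (z - 1) * u z"
  proof -
    have "(\<lambda>z. g z - g 0 - (g 1 - g 0) * z) holomorphic_on UNIV"
      using assms by (intro holomorphic_intros)
    from fac[OF this] show ?thesis using that by auto
  qed
  obtain s where s: "s holomorphic_on UNIV" "\<And>z. sin (of_real pi * z) = z * (z - 1) * s z"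
    using fac[of "\<lambda>z. sin (of_real pi * z)"] 
    by (auto intro!: holomorphic_intros simp flip: sin_of_real)
  \<comment> \<open>The only integers in the ball are 0 and 1. A zero of \<open>s\<close> there
    would be a double zero of the sine, but the derivative \<open>pi * cos (pi * z)\<close> does not
    vanish at integers.\<close>
  have nz: "s z \<noteq> 0" if z: "z \<in> ball (1/2) 1" for z
  proof
    assume s0: "s z = 0"
    then have "sin (of_real pi * z) = 0" using s(2) by simp
    then obtain n :: int where "of_real pi * z = of_real (n * pi)"
      by (auto simp: sin_eq_0)
    then have zn: "z = of_int n" by (simp add: field_simps)
    have "\<bar>of_int n - 1/2 :: real\<bar> < 1"
    proof -
      have "cmod (of_real (1/2 - of_int n)) < 1" using z zn by (simp add: dist_norm)
      then show ?thesis unfolding norm_of_real by linarith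
    qed
    then have "n = 0 \<or> n = 1" by linarith
    moreover have d: "((\<lambda>z. sin (of_real pi * z)) has_field_derivative (of_real pi * cos (of_real pi * z))) (at z)"
      by (auto intro!: derivative_eq_intros)
    have "(s has_field_derivative deriv s z) (at z)"
      using s(1) by (simp add: holomorphic_derivI)
    then have "((\<lambda>z. z * (z - 1) * s z) has_field_derivative ((2*z - 1) * s z + z * (z-1) * deriv s z)) (at z)"
      by (auto intro!: derivative_eq_intros simp: algebra_simps)
    with d have "of_real pi * cos (of_real pi * z) = (2*z - 1) * s z + z * (z-1) * deriv s z"
      unfolding s(2) by (rule DERIV_unique)
    with s0 have "cos (of_real pi * z) = 0 \<or> z * (z - 1) \<noteq> 0" by auto
    ultimately show False using zn
      by (auto simp flip: cos_of_real)
  qed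
  show thesis
  proof
    show "(\<lambda>z. u z / s z) holomorphic_on ball (1/2) 1"
      using u(1) s(1) nz by (auto intro!: holomorphic_intros intro: holomorphic_on_subset)
    show "g z = g 0 + (g 1 - g 0) * z + sin (of_real pi * z) * (u z / s z)" if "z \<in> ball (1/2) 1" for z
    proof -
      have "sin (of_real pi * z) * (u z / s z) = g z - g 0 - (g 1 - g 0) * z"
        using nz[OF that] unfolding u(2) s(2) by simp
      then show ?thesis by simp
    qed
  qed
qed

text \<open>Integration by parts for \<open>k \<noteq> 0\<close>. At \<open>k = 0\<close> the
  right-hand side is 0 by the convention for division by zero, which is the true value since
  \<open>t - 1/2\<close> has mean zero.\<close>

lemma has_integral_exp_linear:
  fixes k :: int
  shows "((\<lambda>t. (of_real t - 1/2) * exp (- (2 * pi * \<i> * of_int k * of_real t))) has_integral (\<i> / (2 * pi * of_int k))) {0..1}"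
proof (cases "k = 0")
  case True
  have "((\<lambda>t. complex_of_real t - 1/2) has_integral ((of_real 1)^2/2 - of_real 1/2 - ((of_real 0)^2/2 - of_real 0/2))) {0..1}"
    by (rule fundamental_theorem_of_calculus)
       (auto intro!: derivative_eq_intros has_vector_derivative_real_field simp: field_simps)
  then show ?thesis using True by simp
next
  case False
  define a where "a = 2 * pi * \<i> * of_int k"
  have a0: "a \<noteq> 0" using False by (simp add: a_def)
  have ea: "exp (- a) = 1"
    using exp_integer_2pi[of "- of_int k"] by (simp add: a_def algebra_simps)
  define F where "F = (\<lambda>z. - (z - 1/2) * exp (- a * z) / a - exp (- a * z) / a^2)"
  have "(F has_field_derivative (z - 1/2) * exp (- a * z)) (at z)" for z
    unfolding F_def using a0
    by (auto intro!: derivative_eq_intros simp: field_simps power2_eq_square)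
  then have "((\<lambda>t. (of_real t - 1/2) * exp (- a * of_real t)) has_integral (F (of_real 1) - F (of_real 0))) {0..1}"
    by (intro fundamental_theorem_of_calculus has_vector_derivative_real_field)
       (auto intro: has_field_derivative_at_within)
  moreover have "F (of_real 1) - F (of_real 0) = \<i> / (2 * pi * of_int k)"
    using ea a0 by (simp add: F_def) (simp add: a_def field_simps)
  ultimately show ?thesis by (simp add: a_def)
qed

lemma has_integral_exp_periodic:
  fixes k :: int
  shows "((\<lambda>t. exp (- (2 * pi * \<i> * of_int k * of_real t))) has_integral (if k = 0 then 1 else 0)) {0..1}"
proof (cases "k = 0")
  case True
  then show ?thesis using has_integral_const_real[of "1::complex" 0 1] by simp
next
  case False
  define a where "a = 2 * pi * \<i> * of_int k"
  have a0: "a \<noteq> 0" using False by (simp add: a_def)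
  have ea: "exp (- a) = 1"
    using exp_integer_2pi[of "- of_int k"] by (simp add: a_def algebra_simps)
  define F where "F = (\<lambda>z. - exp (- a * z) / a)"
  have "(F has_field_derivative exp (- a * z)) (at z)" for z
    unfolding F_def using a0
    by (auto intro!: derivative_eq_intros simp: field_simps power2_eq_square)
  then have "((\<lambda>t. exp (- a * of_real t)) has_integral (F (of_real 1) - F (of_real 0))) {0..1}"
    by (intro fundamental_theorem_of_calculus has_vector_derivative_real_field)
       (auto intro: has_field_derivative_at_within)
  then show ?thesis using False ea by (simp add: F_def a_def)
qed

text \<open>One integration by parts moves the derivative onto \<open>q\<close>: the boundary terms
  and the remaining integral are all of order \<open>1 / m\<close> for a frequency
  \<open>m > 0\<close>. The frequencies in the statement are those of the Dirichlet kernel.\<close>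

lemma Riemann_Lebesgue_sin:
  assumes q: "q holomorphic_on S" and S: "open S" "of_real ` {0..1} \<subseteq> S"
  shows "(\<lambda>K. integral {0..1} (\<lambda>t. sin (of_real (real (2 * K + 1) * pi * t)) * q (of_real t))) \<longlonglongrightarrow> 0"
proof -
  define q' where "q' = (\<lambda>t. deriv q (complex_of_real t))"
  have cq: "continuous_on {0..1} (\<lambda>t. q (of_real t))"
    by (rule continuous_on_compose2[OF holomorphic_on_imp_continuous_on[OF q]]) (use S in \<open>auto intro!: continuous_intros\<close>)
  have cq': "continuous_on {0..1} q'" unfolding q'_def
    by (rule continuous_on_compose2[OF holomorphic_on_imp_continuous_on[OF holomorphic_deriv[OF q S(1)]]])
       (use S in \<open>auto intro!: continuous_intros\<close>)
  have dq: "((\<lambda>t. q (of_real t)) has_vector_derivative q' t) (at t within {0..1})" if "t \<in> {0..1}" for t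
    unfolding q'_def using S that
    by (intro has_vector_derivative_real_field has_field_derivative_at_within[OF holomorphic_derivI[OF q S(1)]]) auto
  obtain B1 where B1: "\<And>t. t \<in> {0..1} \<Longrightarrow> cmod (q (of_real t)) \<le> B1"
    using compact_imp_bounded[OF compact_continuous_image[OF cq compact_Icc]]
    unfolding bounded_iff by blast
  obtain B2 where B2: "\<And>t. t \<in> {0..1} \<Longrightarrow> cmod (q' t) \<le> B2"
    using compact_imp_bounded[OF compact_continuous_image[OF cq' compact_Icc]]
    unfolding bounded_iff by blast
  have B: "cmod (integral {0..1} (\<lambda>t. sin (of_real (m * t)) * q (of_real t))) \<le> (2 * B1 + B2) / m"
    if m: "m > 0" for m :: real
  proof -
    define G where "G = (\<lambda>t. - complex_of_real (cos (m * t) / m) * q (of_real t))"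
    define H where "H = (\<lambda>t. complex_of_real (cos (m * t) / m) * q' t)"
    have d: "(G has_vector_derivative (sin (of_real (m * t)) * q (of_real t) - H t)) (at t within {0..1})"
      if "t \<in> {0..1}" for t
    proof -
      have "((\<lambda>t. - complex_of_real (cos (m * t) / m)) has_vector_derivative of_real (sin (m * t))) (at t within {0..1})"
      proof -
        have "((\<lambda>t. - (cos (m * t) / m)) has_real_derivative sin (m * t)) (at t within {0..1})"
          using m by (auto intro!: derivative_eq_intros)
        from has_vector_derivative_of_real[OF this, where 'a = complex]
        show ?thesis by simp
      qed
      from has_vector_derivative_mult[OF this dq[OF that]]
      show ?thesis by (simp add: G_def H_def algebra_simps flip: sin_of_real del: of_real_divide)
    qed
    have i1: "((\<lambda>t. sin (of_real (m * t)) * q (of_real t) - H t) has_integral (G 1 - G 0)) {0..1}"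
      by (intro fundamental_theorem_of_calculus d) auto
    have cH: "continuous_on {0..1} H" unfolding H_def using m by (intro continuous_intros cq') auto
    then have i2: "(H has_integral integral {0..1} H) {0..1}"
      by (intro integrable_integral integrable_continuous_interval)
    have iH: "cmod (integral {0..1} H) \<le> B2 / m * (1 - 0)"
    proof (rule integral_bound)
      show "cmod (H t) \<le> B2 / m" if "t \<in> {0..1}" for t
      proof -
        have "cmod (H t) = \<bar>cos (m * t)\<bar> * cmod (q' t) / m"
          using m by (simp add: H_def norm_mult norm_divide del: of_real_divide)
        also have "\<dots> \<le> 1 * B2 / m"
          using B2[OF that] m by (intro divide_right_mono mult_mono) auto
        finally show ?thesis by simp
      qed
    qed (use cH in auto)
    have g: "cmod (G t) \<le> B1 / m" if "t \<in> {0..1}" for t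
    proof -
      have "cmod (G t) = \<bar>cos (m * t)\<bar> * cmod (q (of_real t)) / m"
        using m by (simp add: G_def norm_mult norm_divide del: of_real_divide)
      also have "\<dots> \<le> 1 * B1 / m"
        using B1[OF that] m by (intro divide_right_mono mult_mono) auto
      finally show ?thesis by simp
    qed
    have "integral {0..1} (\<lambda>t. sin (of_real (m * t)) * q (of_real t)) = G 1 - G 0 + integral {0..1} H"
      using has_integral_add[OF i1 i2] by (simp add: integral_unique)
    also have "cmod \<dots> \<le> cmod (G 1) + cmod (G 0) + cmod (integral {0..1} H)"
      by (rule order_trans[OF norm_triangle_ineq]) (intro add_right_mono norm_triangle_ineq4)
    also have "\<dots> \<le> (2 * B1 + B2) / m"
      using g[of 0] g[of 1] iH by (simp add: add_divide_distrib)
    finally show ?thesis .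
  qed
  show ?thesis
  proof (rule Lim_null_comparison)
    show "\<forall>\<^sub>F K in sequentially. cmod (integral {0..1} (\<lambda>t. sin (of_real (real (2 * K + 1) * pi * t)) * q (of_real t)))
       \<le> (2 * B1 + B2) / (real (2 * K + 1) * pi)"
      by (intro always_eventually allI B) simp
    show "(\<lambda>K. (2 * B1 + B2) / (real (2 * K + 1) * pi)) \<longlonglongrightarrow> 0" by real_asymp
  qed
qed

text \<open>On the unit interval \<open>g\<close> splits into the mean of its endpoint values, a
  multiple of \<open>t - 1/2\<close>, and a multiple of \<open>sin (pi * t)\<close>. The first
  contributes only at \<open>k = 0\<close>, the second has coefficients odd in \<open>k\<close>, and
  the third meets the Dirichlet kernel and tends to 0.\<close>

theorem Fourier_series_endpoint:
  assumes g: "g holomorphic_on UNIV"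
  shows "(\<lambda>K. \<Sum>k=-int K..int K. integral {0..1} (\<lambda>t. g (of_real t) * exp (- (2 * pi * \<i> * of_int k * of_real t))))
    \<longlonglongrightarrow> (g 0 + g 1) / 2"
proof -
  obtain q where q: "q holomorphic_on ball (1/2) 1"
    "\<And>z. z \<in> ball (1/2) 1 \<Longrightarrow> g z = g 0 + (g 1 - g 0) * z + sin (of_real pi * z) * q z"
    using holomorphic_div_sin_on_unit[OF g] by blast
  have sub: "complex_of_real ` {0..1} \<subseteq> ball (1/2) 1"
  proof
    fix z assume "z \<in> complex_of_real ` {0..1}"
    then obtain t where t: "z = of_real t" "0 \<le> t" "t \<le> 1" by auto
    have "cmod (1/2 - z) = cmod (of_real (1/2 - t))" by (simp add: t)
    also have "\<dots> < 1" unfolding norm_of_real using t by linarith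
    finally show "z \<in> ball (1/2) 1" by (simp add: dist_norm)
  qed
  define e where "e = (\<lambda>(k::int) (t::real). exp (- (2 * pi * \<i> * of_int k * of_real t)))"
  have cq: "continuous_on {0..1} (\<lambda>t. q (of_real t))"
    by (rule continuous_on_compose2[OF holomorphic_on_imp_continuous_on[OF q(1)]]) (use sub in \<open>auto intro!: continuous_intros\<close>)
  have "(\<Sum>k=-int K..int K. integral {0..1} (\<lambda>t. g (of_real t) * e k t))
     = (g 0 + g 1) / 2 + integral {0..1} (\<lambda>t. sin (of_real (real (2 * K + 1) * pi * t)) * q (of_real t))" for K
  proof -
    let ?A = "{-int K..int K}"
    have i3: "(\<lambda>t. sin (of_real (pi * t)) * e k t * q (of_real t)) integrable_on {0..1}" for k
      unfolding e_def by (intro integrable_continuous_interval continuous_intros cq)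
    have "((\<lambda>t. g (of_real t) * e k t) has_integral
        (((g 0 + g 1) / 2) * (if k = 0 then 1 else 0) + (g 1 - g 0) * (\<i> / (2 * pi * of_int k))
          + integral {0..1} (\<lambda>t. sin (of_real (pi * t)) * e k t * q (of_real t)))) {0..1}" for k
    proof (rule has_integral_eq)
      show "((\<lambda>t. ((g 0 + g 1) / 2) * e k t + (g 1 - g 0) * ((of_real t - 1/2) * e k t) + sin (of_real (pi * t)) * e k t * q (of_real t))
         has_integral (((g 0 + g 1) / 2) * (if k = 0 then 1 else 0) + (g 1 - g 0) * (\<i> / (2 * pi * of_int k))
          + integral {0..1} (\<lambda>t. sin (of_real (pi * t)) * e k t * q (of_real t)))) {0..1}"
        using has_integral_exp_linear[of k] has_integral_exp_periodic[of k] i3[of k]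
        by (intro has_integral_add has_integral_mult_right) (auto simp: e_def integrable_integral)
      show "((g 0 + g 1) / 2) * e k t + (g 1 - g 0) * ((of_real t - 1/2) * e k t) + sin (of_real (pi * t)) * e k t * q (of_real t)
           = g (of_real t) * e k t" if "t \<in> {0..1}" for t
      proof -
        have "g (of_real t) = g 0 + (g 1 - g 0) * of_real t + sin (of_real (pi * t)) * q (of_real t)"
          using q(2)[of "of_real t"] sub that by (simp add: image_subset_iff)
        also have "g 0 + (g 1 - g 0) * of_real t = (g 0 + g 1) / 2 + (g 1 - g 0) * (of_real t - 1/2)"
          by (simp add: field_simps)
        finally show ?thesis by (simp only: ring_distribs mult_ac)
      qed
    qed
    then have "(\<Sum>k\<in>?A. integral {0..1} (\<lambda>t. g (of_real t) * e k t))
      = (\<Sum>k\<in>?A. ((g 0 + g 1) / 2) * (if k = 0 then 1 else 0) + (g 1 - g 0) * (\<i> / (2 * pi * of_int k))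
          + integral {0..1} (\<lambda>t. sin (of_real (pi * t)) * e k t * q (of_real t)))"
      by (intro sum.cong refl integral_unique)
    also have "\<dots> = (g 0 + g 1) / 2 * (\<Sum>k\<in>?A. if k = 0 then 1 else 0) + (g 1 - g 0) * (\<Sum>k\<in>?A. \<i> / (2 * pi * of_int k))
         + (\<Sum>k\<in>?A. integral {0..1} (\<lambda>t. sin (of_real (pi * t)) * e k t * q (of_real t)))"
      by (simp only: sum.distrib sum_distrib_left)
    also have "(\<Sum>k\<in>?A. (if k = 0 then 1 else 0 :: complex)) = 1" by (simp add: sum.delta)
    \<comment> \<open>This is where the symmetric range matters: reflecting \<open>k\<close> shows
      that the sum equals its own negative.\<close>
    also have "(\<Sum>k\<in>?A. \<i> / (2 * pi * of_int k)) = 0"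
    proof -
      have "(\<Sum>k\<in>?A. \<i> / (2 * pi * of_int k)) = (\<Sum>k\<in>?A. \<i> / (2 * pi * of_int (-k)))"
        by (rule sum.reindex_bij_witness[of _ uminus uminus]) auto
      then show ?thesis by (simp add: sum_negf)
    qed
    also have "(\<Sum>k\<in>?A. integral {0..1} (\<lambda>t. sin (of_real (pi * t)) * e k t * q (of_real t)))
       = integral {0..1} (\<lambda>t. \<Sum>k\<in>?A. sin (of_real (pi * t)) * e k t * q (of_real t))"
      by (rule integral_sum[symmetric]) (use i3 in auto)
    also have "(\<lambda>t. \<Sum>k\<in>?A. sin (of_real (pi * t)) * e k t * q (of_real t))
       = (\<lambda>t. sin (of_real (real (2 * K + 1) * pi * t)) * q (of_real t))"
      unfolding e_def sin_mult_sum_exp[symmetric] sum_distrib_left sum_distrib_right ..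
    finally show ?thesis by simp
  qed
  moreover have "(\<lambda>K. (g 0 + g 1) / 2 + integral {0..1} (\<lambda>t. sin (of_real (real (2 * K + 1) * pi * t)) * q (of_real t)))
     \<longlonglongrightarrow> (g 0 + g 1) / 2 + 0"
    by (intro tendsto_intros Riemann_Lebesgue_sin[OF q(1) _ sub]) auto
  ultimately show ?thesis by (simp add: e_def)
qed

section \<open>Partial fractions of the cotangent\<close>

lemma sum_symmetric_interval:
  fixes h :: "int \<Rightarrow> 'a :: ab_group_add"
  shows "(\<Sum>k=-int K..int K. h k) = h 0 + (\<Sum>j<K. h (int j + 1) + h (- (int j + 1)))"
proof (induction K)
  case (Suc K)
  have "{- int (Suc K)..int (Suc K)} = insert (- int (Suc K)) (insert (int (Suc K)) {-int K..int K})"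
    by auto
  then show ?case using Suc by (simp add: algebra_simps)
qed simp

text \<open>The endpoint theorem is applied to \<open>exp (2 * pi * \<i> * a * z)\<close>. Its
  coefficients are \<open>(E - 1) / (2 * pi * \<i> * (a - k))\<close> and its endpoint mean is
  \<open>(1 + E) / 2\<close>, so the symmetric sums of \<open>1 / (a - k)\<close> tend to
  \<open>pi * \<i> * (E + 1) / (E - 1) = pi * cot (pi * a)\<close>. Pairing \<open>k\<close> with
  \<open>-k\<close> gives the series.\<close>

lemma cot_partial_fractions:
  fixes a :: real
  assumes a: "\<bar>a\<bar> < 1" "a \<noteq> 0"
  shows "(\<lambda>j. 1 / (real j + 1 + a) - 1 / (real j + 1 - a)) sums (pi * cot (pi * a) - 1 / a)"
proof -
  define h where "h = (\<lambda>k::int. 1 / (a - of_int k))"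
  have nz: "a - of_int k \<noteq> 0" for k
  proof
    assume "a - of_int k = 0"
    then have "a = of_int k" by simp
    with a show False by simp
  qed
  define E where "E = exp (2 * pi * \<i> * a)"
  define s c where "s = sin (pi * a)" and "c = cos (pi * a)"
  have s0: "s \<noteq> 0"
  proof
    assume "s = 0"
    then obtain k :: int where "pi * a = of_int k * pi" unfolding s_def using sin_zero_iff_int2 by metis
    then show False using nz[of k] by simp
  qed
  \<comment> \<open>The common factor \<open>c + \<i> * s\<close> is
    \<open>exp (\<i> * pi * a)\<close>; it cancels in the quotient and leaves the cotangent.\<close>
  have E1: "E - 1 = 2 * \<i> * s * (c + \<i> * s)" "E + 1 = 2 * c * (c + \<i> * s)"
  proof -
    have "E = exp (\<i> * of_real (2 * (pi * a)))" by (simp add: E_def algebra_simps)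
    also have "\<dots> = of_real (cos (2 * (pi * a))) + \<i> * of_real (sin (2 * (pi * a)))"
      unfolding exp_Euler by (simp only: cos_of_real sin_of_real)
    also have "\<dots> = (c + \<i> * s)^2"
      unfolding cos_double sin_double c_def s_def by (simp add: power2_eq_square algebra_simps)
    finally have E: "E = (c + \<i> * s)^2" .
    have cs: "of_real c ^ 2 + of_real s ^ 2 = (1 :: complex)"
      unfolding c_def s_def of_real_power[symmetric] of_real_add[symmetric] by simp
    show "E - 1 = 2 * \<i> * s * (c + \<i> * s)" "E + 1 = 2 * c * (c + \<i> * s)"
      unfolding E using cs by (simp_all add: power2_eq_square algebra_simps)
  qed
  have cs0: "c + \<i> * s \<noteq> 0" using s0 by (simp add: complex_eq_iff)
  have E0: "E - 1 \<noteq> 0" using s0 cs0 by (simp add: E1)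
  have int: "integral {0..1} (\<lambda>t. exp (2 * pi * \<i> * a * of_real t) * exp (- (2 * pi * \<i> * of_int k * of_real t)))
     = (E - 1) / (2 * pi * \<i>) * of_real (h k)" for k
  proof -
    define b where "b = 2 * pi * \<i> * of_real (a - of_int k)"
    have b0: "b \<noteq> 0" using nz[of k] by (simp add: b_def del: of_real_diff)
    have "((\<lambda>z. exp (b * z) / b) has_field_derivative exp (b * z)) (at z within X)" for z X
      using b0 by (auto intro!: derivative_eq_intros)
    then have "((\<lambda>t. exp (b * of_real t)) has_integral (exp (b * of_real 1) / b - exp (b * of_real 0) / b)) {0..1}"
      by (intro fundamental_theorem_of_calculus has_vector_derivative_real_field) auto
    moreover have "exp b = E"
      using exp_integer_2pi[of "- of_int k"]
      by (simp add: b_def E_def ring_distribs exp_diff exp_minus mult_ac)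
    moreover have "exp (2 * pi * \<i> * a * of_real t) * exp (- (2 * pi * \<i> * of_int k * of_real t)) = exp (b * of_real t)" for t
      unfolding exp_add[symmetric] b_def by (simp add: algebra_simps)
    ultimately show ?thesis using b0 nz[of k]
      by (simp add: integral_unique b_def h_def diff_divide_distrib)
  qed
  have "(\<lambda>z. exp (2 * pi * \<i> * a * z)) holomorphic_on UNIV" by (intro holomorphic_intros)
  from Fourier_series_endpoint[OF this]
  have "(\<lambda>K. (E - 1) / (2 * pi * \<i>) * of_real (\<Sum>k=-int K..int K. h k)) \<longlonglongrightarrow> (1 + E) / 2"
    unfolding int by (simp add: sum_distrib_left E_def)
  from tendsto_mult_left[OF this, of "2 * pi * \<i> / (E - 1)"]
  have "(\<lambda>K. complex_of_real (\<Sum>k=-int K..int K. h k)) \<longlonglongrightarrow> 2 * pi * \<i> / (E - 1) * ((1 + E) / 2)"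
    using E0 by simp
  also have "2 * pi * \<i> / (E - 1) * ((1 + E) / 2) = of_real (pi * cot (pi * a))"
    unfolding add.commute[of 1 E] E1 using s0 cs0 by (simp add: cot_def flip: c_def s_def)
  finally have "(\<lambda>K. \<Sum>k=-int K..int K. h k) \<longlonglongrightarrow> pi * cot (pi * a)"
    unfolding tendsto_of_real_iff .
  then have "(\<lambda>K. h 0 + (\<Sum>j<K. h (int j + 1) + h (- (int j + 1)))) \<longlonglongrightarrow> pi * cot (pi * a)"
    unfolding sum_symmetric_interval .
  from tendsto_diff[OF this tendsto_const[of "h 0"]]
  have "(\<lambda>j. h (int j + 1) + h (- (int j + 1))) sums (pi * cot (pi * a) - 1 / a)"
    by (simp add: sums_def h_def)
  moreover have "h (int j + 1) + h (- (int j + 1)) = 1 / (real j + 1 + a) - 1 / (real j + 1 - a)" for j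
  proof -
    have "a - (real j + 1) \<noteq> 0" using nz[of "int j + 1"] by simp
    then have "1 / (a - (real j + 1)) = - (1 / (real j + 1 - a))"
      by (metis minus_diff_eq minus_divide_right)
    then show ?thesis unfolding h_def by (simp add: add_ac)
  qed
  ultimately show ?thesis by simp
qed

subsection \<open>The complementary error function\<close>

text \<open>The integrand is entire, hence has a primitive on the whole plane, and the contour
  integral is a difference of two of its values.\<close>

lemma erfc_has_field_derivative:
  "(erfc has_field_derivative - 2 / complex_of_real (sqrt pi) * exp (- (z^2))) (at z)"
proof -
  have "(\<lambda>u::complex. exp (- (u^2))) holomorphic_on UNIV" by (intro holomorphic_intros)
  then obtain F where F: "\<And>z::complex. (F has_field_derivative exp (- (z^2))) (at z)"
    using holomorphic_convex_primitive'[of UNIV "\<lambda>u. exp (- (u^2))"] by auto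
  have "contour_integral (linepath 0 z) (\<lambda>u. exp (- (u^2))) = F z - F 0" for z
    using contour_integral_primitive[of UNIV F "\<lambda>u. exp (- (u^2))" "linepath 0 z"] F
    by (intro contour_integral_unique) simp
  then have e: "erfc = (\<lambda>z. 1 - 2 / complex_of_real (sqrt pi) * (F z - F 0))"
    by (simp add: erfc_def fun_eq_iff)
  show ?thesis unfolding e by (auto intro!: derivative_eq_intros F)
qed

lemma erfc_0: "erfc 0 = 1"
  by (simp add: erfc_def)

text \<open>The derivative of \<open>erfc (- z) + erfc z\<close> vanishes identically, so the sum
  keeps its value 2 from \<open>z = 0\<close>.\<close>

lemma erfc_minus: "erfc (- z) = 2 - erfc z"
proof -
  have "((\<lambda>z. erfc (- z) + erfc z) has_field_derivative 0) (at z)" for z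
  proof -
    have "((\<lambda>z. erfc (- z)) has_field_derivative - 2 / complex_of_real (sqrt pi) * exp (- ((-z)^2)) * (- 1)) (at z)"
      by (rule DERIV_chain2[OF erfc_has_field_derivative]) (auto intro!: derivative_eq_intros)
    from DERIV_add[OF this erfc_has_field_derivative[of z]] show ?thesis by simp
  qed
  then obtain c where c: "\<And>z. erfc (- z) + erfc z = c"
    using has_field_derivative_zero_constant[of UNIV "\<lambda>z. erfc (- z) + erfc z"] by auto
  show ?thesis using c[of 0] c[of z] by (simp add: erfc_0 eq_diff_eq)
qed

text \<open>This is the Gaussian integral: over the half-line it equals \<open>sqrt pi / 2\<close>,
  exactly what cancels the 1 in the definition of \<open>erfc\<close>.\<close>

lemma erfc_of_real_tendsto_0: "((\<lambda>p::real. erfc (of_real p)) \<longlongrightarrow> 0) at_top"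
proof -
  have "has_bochner_integral lborel (\<lambda>x::real. indicator {0..} x *\<^sub>R exp (- x\<^sup>2)) (sqrt pi / 2)"
    by (rule gaussian_moment_0)
  then have i: "set_integrable lborel {0..} (\<lambda>x::real. exp (- x\<^sup>2))"
    and v: "set_lebesgue_integral lborel {0..} (\<lambda>x::real. exp (- x\<^sup>2)) = sqrt pi / 2"
    by (auto simp: set_integrable_def set_lebesgue_integral_def has_bochner_integral_iff)
  have "((\<lambda>b. set_lebesgue_integral lborel {0..b} (\<lambda>x::real. exp (- x\<^sup>2))) \<longlongrightarrow> sqrt pi / 2) at_top"
    using tendsto_set_lebesgue_integral_at_top[OF _ i] v by simp
  then have "((\<lambda>b. complex_of_real (1 - 2 / sqrt pi * set_lebesgue_integral lborel {0..b} (\<lambda>x::real. exp (- x\<^sup>2)))) \<longlongrightarrow>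
     of_real (1 - 2 / sqrt pi * (sqrt pi / 2))) at_top"
    by (intro tendsto_intros)
  then have "((\<lambda>b. complex_of_real (1 - 2 / sqrt pi * set_lebesgue_integral lborel {0..b} (\<lambda>x::real. exp (- x\<^sup>2)))) \<longlongrightarrow> 0) at_top"
    by simp
  moreover have "\<forall>\<^sub>F b in at_top. complex_of_real (1 - 2 / sqrt pi * set_lebesgue_integral lborel {0..b} (\<lambda>x::real. exp (- x\<^sup>2))) = erfc (of_real b)"
    using eventually_ge_at_top[of 0]
  proof eventually_elim
    case (elim b)
    have "((\<lambda>t. - 2 / complex_of_real (sqrt pi) * exp (- (of_real t^2))) has_integral (erfc (of_real b) - erfc (of_real 0))) {0..b}"
      using elim by (intro fundamental_theorem_of_calculus has_vector_derivative_real_field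
         has_field_derivative_at_within[OF erfc_has_field_derivative]) auto
    moreover have "((\<lambda>x::real. exp (- x\<^sup>2)) has_integral set_lebesgue_integral lborel {0..b} (\<lambda>x::real. exp (- x\<^sup>2))) {0..b}"
    proof -
      have "set_integrable lborel {0..b} (\<lambda>x::real. exp (- x\<^sup>2))"
        by (rule set_integrable_subset[OF i]) auto
      from set_borel_integral_eq_integral[OF this] show ?thesis by (simp add: has_integral_integral)
    qed
    from has_integral_mult_right[OF has_integral_of_real[OF this], of "- 2 / complex_of_real (sqrt pi)"]
    have "((\<lambda>t. - 2 / complex_of_real (sqrt pi) * exp (- (of_real t^2))) has_integral 
       (- 2 / complex_of_real (sqrt pi) * of_real (set_lebesgue_integral lborel {0..b} (\<lambda>x::real. exp (- x\<^sup>2))))) {0..b}"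
      by (simp flip: exp_of_real)
    ultimately have "erfc (of_real b) - erfc (of_real 0) = - 2 / complex_of_real (sqrt pi) * of_real (set_lebesgue_integral lborel {0..b} (\<lambda>x::real. exp (- x\<^sup>2)))"
      by (rule has_integral_unique)
    then show ?case by (simp add: erfc_0 algebra_simps)
  qed
  ultimately show ?thesis by (rule Lim_transform_eventually)
qed

text \<open>Decay is carried over from the real axis to the hyperbola on which the square has
  imaginary part \<open>- b\<close>. With \<open>u = p + \<i> * q\<close>, the real part
  \<open>p\<close> is at least \<open>sqrt v\<close>, and the step from \<open>p\<close> to
  \<open>u\<close> changes \<open>erfc\<close> by at most a multiple of
  \<open>exp (- v)\<close>.\<close>

lemma erfc_csqrt_tendsto_0:
  fixes b :: real
  shows "((\<lambda>v::real. erfc (csqrt (of_real v - \<i> * of_real b))) \<longlongrightarrow> 0) at_top"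
proof -
  define u where "u = (\<lambda>v::real. csqrt (of_real v - \<i> * of_real b))"
  define p where "p = (\<lambda>v. Re (u v))"
  define q where "q = (\<lambda>v. Im (u v))"
  have u2: "u v ^ 2 = of_real v - \<i> * of_real b" for v by (simp add: u_def)
  have pq: "p v ^ 2 - q v ^ 2 = v" "2 * p v * q v = - b" for v
    using u2[of v] by (auto simp: complex_eq_iff p_def q_def power2_eq_square mult_ac)
  have p0: "p v \<ge> 0" for v using csqrt_principal[of "of_real v - \<i> * of_real b"] by (auto simp: p_def u_def)
  have pge: "p v \<ge> sqrt v" for v
    using pq(1)[of v] p0[of v] zero_le_power2[of "q v"] by (intro real_le_lsqrt) linarith+
  have pl: "filterlim p at_top at_top"
    by (rule filterlim_at_top_mono[OF sqrt_at_top]) (use pge in auto)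
  have l1: "((\<lambda>v. erfc (of_real (p v))) \<longlongrightarrow> 0) at_top"
    by (rule filterlim_compose[OF erfc_of_real_tendsto_0 pl])
  have l2: "((\<lambda>v. erfc (u v) - erfc (of_real (p v))) \<longlongrightarrow> 0) at_top"
  proof (rule Lim_null_comparison)
    show "\<forall>\<^sub>F v in at_top. cmod (erfc (u v) - erfc (of_real (p v))) \<le> 2 / sqrt pi * exp (- v) * \<bar>b\<bar>"
      using eventually_ge_at_top[of 1]
    proof eventually_elim
      case (elim v)
      have uv: "u v = Complex (p v) (q v)" by (simp add: p_def q_def)
      have "cmod (erfc (u v) - erfc (of_real (p v))) \<le> 2 / sqrt pi * exp (- v) * cmod (u v - of_real (p v))"
      proof (rule field_differentiable_bound[OF convex_closed_segment])
        show "(erfc has_field_derivative - 2 / complex_of_real (sqrt pi) * exp (- (z^2))) (at z within closed_segment (u v) (of_real (p v)))" for z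
          by (rule has_field_derivative_at_within[OF erfc_has_field_derivative])
        show "cmod (- 2 / complex_of_real (sqrt pi) * exp (- (z^2))) \<le> 2 / sqrt pi * exp (- v)"
          if z: "z \<in> closed_segment (u v) (of_real (p v))" for z
        proof -
          obtain t where t: "0 \<le> t" "t \<le> 1" "z = (1 - t) *\<^sub>R u v + t *\<^sub>R of_real (p v)"
            using z by (auto simp: closed_segment_def)
          \<comment> \<open>The segment is vertical, so the real part of \<open>z^2\<close> is
            \<open>p^2 - (1 - t)^2 * q^2\<close>; it is smallest at the end \<open>u v\<close>,
            where it equals \<open>v\<close>.\<close>
          have zz: "Re z = p v" "Im z = (1 - t) * q v" unfolding t(3) by (simp_all add: uv algebra_simps)
          have "(1 - t)^2 * q v ^ 2 \<le> 1 * q v ^ 2"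
            using t by (intro mult_right_mono power_le_one) auto
          then have "Re (z^2) \<ge> v" using pq(1)[of v] 
            by (simp add: power2_eq_square zz algebra_simps)
          then show ?thesis by (simp add: norm_mult norm_divide mult_left_mono divide_right_mono)
        qed
      qed auto
      also have "cmod (u v - of_real (p v)) \<le> \<bar>b\<bar>"
      proof -
        have "p v \<ge> 1" using pge[of v] elim by (meson order_trans real_sqrt_ge_1_iff)
        then have "1 * \<bar>q v\<bar> \<le> (2 * p v) * \<bar>q v\<bar>" by (intro mult_right_mono) auto
        also have "\<dots> = \<bar>b\<bar>" using pq(2)[of v] p0[of v] by (metis abs_minus abs_mult abs_of_nonneg abs_numeral)
        finally show ?thesis by (simp add: uv cmod_def)
      qed
      finally show ?case by (simp add: mult_left_mono divide_right_mono)
    qed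
    show "((\<lambda>v. 2 / sqrt pi * exp (- v) * \<bar>b\<bar>) \<longlongrightarrow> 0) at_top" by real_asymp
  qed
  show ?thesis using tendsto_add[OF l1 l2] by (simp add: u_def)
qed

text \<open>Multiplied by \<open>exp (-z\<^sup>2)\<close>, the truncated series has derivative \<open>-2 exp (-z\<^sup>2)\<close> up to a single
  term. The difference is followed along the path \<open>u(v) = csqrt (z\<^sup>2 + v)\<close>, \<open>v \<ge> 0\<close>, on which
  \<open>exp (-u\<^sup>2)\<close> decays without oscillating and \<open>\<bar>u\<bar>\<close> never drops below \<open>a\<close>.\<close>

theorem erfc_asymptotic_expansion:
  fixes a :: real
  assumes a: "a > 0" and z: "z = exp (- (pi * \<i> / 4)) * of_real a"
  shows "cmod (complex_of_real (sqrt pi) * exp (z^2) * erfc z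
            - (\<Sum>r<n. (-1)^r * pochhammer (1/2) r / z ^ (2 * r + 1)))
         \<le> pochhammer (1/2) n / a ^ (2 * n + 1)"
proof -
  define P where "P = (\<lambda>r. pochhammer (1/2 :: complex) r)"
  define P' where "P' = (\<lambda>r. pochhammer (1/2 :: real) r)"
  have PP: "cmod (P r) = P' r" for r
  proof -
    have "P r = of_real (P' r)" unfolding P_def P'_def pochhammer_of_real[symmetric] by simp
    moreover have "P' r \<ge> 0" unfolding P'_def by (intro pochhammer_nonneg) simp
    ultimately show ?thesis by simp
  qed
  \<comment> \<open>Written as the principal root of \<open>- \<i>\<close>, the direction of
    \<open>z\<close> makes \<open>z^2\<close> purely imaginary, and the path through principal roots
    below starts at \<open>z\<close>.\<close>
  have ez: "exp (- (pi * \<i> / 4)) = csqrt (- \<i>)"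
  proof (rule csqrt_unique[symmetric])
    have "exp (- (pi * \<i> / 4)) ^ 2 = exp (- (\<i> * of_real (pi/2)))"
      by (simp add: exp_double[symmetric] mult_ac)
    also have "\<dots> = - \<i>" unfolding exp_minus exp_Euler cos_of_real sin_of_real by simp
    finally show "exp (- (pi * \<i> / 4)) ^ 2 = - \<i>" .
    have "Re (exp (- (pi * \<i> / 4))) = cos (pi/4)" by (simp add: Re_exp)
    also have "\<dots> > 0" by (intro cos_gt_zero) auto
    finally show "0 < Re (exp (- (pi * \<i> / 4))) \<or> Re (exp (- (pi * \<i> / 4))) = 0 \<and> 0 \<le> Im (exp (- (pi * \<i> / 4)))"
      by simp
  qed
  have z2: "z^2 = - \<i> * of_real (a^2)"
    unfolding z ez power_mult_distrib by simp
  define u where "u = (\<lambda>v::real. csqrt (of_real v - \<i> * of_real (a^2)))"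
  have u2: "u v ^ 2 = of_real v - \<i> * of_real (a^2)" for v by (simp add: u_def)
  have u0: "u 0 = z"
  proof -
    have "Re z > 0"
    proof -
      have "Re z = cos (pi/4) * a" unfolding z by (simp add: Re_exp Im_exp)
      also have "\<dots> > 0" using a by (intro mult_pos_pos cos_gt_zero) auto
      finally show ?thesis .
    qed
    then show ?thesis unfolding u_def using z2 by (intro csqrt_unique) auto
  qed
  have unz: "u v \<noteq> 0" for v
    using u2[of v] a by (auto simp: complex_eq_iff)
  \<comment> \<open>Along the path the imaginary part of the square stays at \<open>- (a^2)\<close>,
    which already bounds the modulus from below.\<close>
  have un: "cmod (u v) \<ge> a" for v
  proof -
    have "a^2 \<le> cmod (of_real v - \<i> * of_real (a^2))"
      using abs_Im_le_cmod[of "of_real v - \<i> * of_real (a^2)"] by simp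
    also have "\<dots> = cmod (u v) ^ 2" by (simp add: u2 flip: norm_power)
    finally show ?thesis using power2_le_imp_le[of a "cmod (u v)"] by simp
  qed
  have ud: "(u has_vector_derivative inverse (2 * u v)) (at v)" for v
  proof -
    have "((\<lambda>w. csqrt (w - \<i> * of_real (a^2))) has_field_derivative inverse (2 * u v)) (at (of_real v))"
      unfolding u_def using a
      by (auto intro!: derivative_eq_intros simp: complex_nonpos_Reals_iff inverse_eq_divide)
    from has_vector_derivative_real_field[OF this] show ?thesis by (simp add: u_def)
  qed
  define Q where "Q = (\<lambda>m w. \<Sum>r<m. (-1)^r * P r / w ^ (2 * r + 1))"
  \<comment> \<open>Differentiating \<open>exp (- (w^2)) / w ^ (2 * m + 1)\<close> yields a piece in
    \<open>w ^ (2 * m)\<close> and one in \<open>w ^ (2 * m + 2)\<close>. By the Pochhammer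
    recurrence neighbouring pieces cancel, so only the leading 1 and the last piece survive.\<close>
  have Qd: "((\<lambda>w. exp (- (w^2)) * Q m w) has_field_derivative
         (- 2 * exp (- (w^2)) * (1 - (-1)^m * P m / w ^ (2 * m)))) (at w)" if w: "w \<noteq> 0" for w m
  proof (induction m)
    case 0
    then show ?case by (simp add: Q_def P_def)
  next
    case (Suc m)
    have Ps: "P (Suc m) = P m * (1/2 + of_nat m)" by (simp add: P_def pochhammer_Suc)
    have "((\<lambda>w. exp (- (w^2)) * ((-1)^m * P m / w ^ (2 * m + 1))) has_field_derivative
        (-1)^m * P m * exp (- (w^2)) * (- 2 * w * inverse (w ^ (2*m+1)) - of_nat (2*m+1) * inverse (w ^ (2*m+2)))) (at w)"
    proof -
      have d1: "((\<lambda>w. exp (- (w^2))) has_field_derivative - 2 * w * exp (- (w^2))) (at w)"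
        by (auto intro!: derivative_eq_intros)
      have "((\<lambda>w. w ^ Suc (2*m)) has_field_derivative (1 + of_nat (2*m)) * (1 * w ^ (2*m))) (at w)"
        by (rule DERIV_power_Suc[OF DERIV_ident])
      from DERIV_inverse_fun[OF this] w
      have d2: "((\<lambda>w. inverse (w ^ (2*m+1))) has_field_derivative
          - ((1 + of_nat (2*m)) * (1 * w ^ (2*m)) * inverse ((w ^ Suc (2*m)) ^ Suc (Suc 0)))) (at w)"
        by simp
      also have "- ((1 + of_nat (2*m)) * (1 * w ^ (2*m)) * inverse ((w ^ Suc (2*m)) ^ Suc (Suc 0)))
          = - (of_nat (2*m+1) * inverse (w ^ (2*m+2)))"
        using w by (simp add: field_simps)
      finally have d2: "((\<lambda>w. inverse (w ^ (2*m+1))) has_field_derivative - (of_nat (2*m+1) * inverse (w ^ (2*m+2)))) (at w)" .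
      have "((\<lambda>w. (-1)^m * P m * (exp (- (w^2)) * inverse (w ^ (2*m+1)))) has_field_derivative
        (-1)^m * P m * exp (- (w^2)) * (- 2 * w * inverse (w ^ (2*m+1)) - of_nat (2*m+1) * inverse (w ^ (2*m+2)))) (at w)"
        by (rule DERIV_cong[OF DERIV_cmult[OF DERIV_mult[OF d1 d2]]]) (simp only: ring_distribs mult_ac, simp)
      then show ?thesis by (simp only: divide_inverse mult_ac)
    qed
    from DERIV_add[OF Suc this] have "((\<lambda>w. exp (- (w^2)) * Q (Suc m) w) has_field_derivative
      - 2 * exp (- (w^2)) * (1 - (-1)^m * P m / w ^ (2 * m)) + 
       (-1)^m * P m * exp (- (w^2)) * (- 2 * w * inverse (w ^ (2*m+1)) - of_nat (2*m+1) * inverse (w ^ (2*m+2)))) (at w)"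
      by (simp add: Q_def ring_distribs)
    also have "- 2 * exp (- (w^2)) * (1 - (-1)^m * P m / w ^ (2 * m)) + 
       (-1)^m * P m * exp (- (w^2)) * (- 2 * w * inverse (w ^ (2*m+1)) - of_nat (2*m+1) * inverse (w ^ (2*m+2)))
      = - 2 * exp (- (w^2)) * (1 - (-1)^Suc m * P (Suc m) / w ^ (2 * Suc m))"
      using w unfolding Ps by (simp add: field_simps)
    finally show ?case .
  qed
  define g where "g = (\<lambda>w. complex_of_real (sqrt pi) * erfc w - exp (- (w^2)) * Q n w)"
  have gd: "(g has_field_derivative (- 2 * exp (- (w^2)) * ((-1)^n * P n / w ^ (2 * n)))) (at w)" if "w \<noteq> 0" for w
  proof -
    have "(g has_field_derivative complex_of_real (sqrt pi) * (- 2 / complex_of_real (sqrt pi) * exp (- (w^2)))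
       - (- 2 * exp (- (w^2)) * (1 - (-1)^n * P n / w ^ (2 * n)))) (at w)"
      unfolding g_def by (intro DERIV_diff DERIV_cmult erfc_has_field_derivative Qd that)
    then show ?thesis by (simp add: algebra_simps)
  qed
  \<comment> \<open>The normalisation by \<open>exp (z^2)\<close> turns
    \<open>exp (- (u v^2))\<close> into \<open>exp (- v)\<close>, and the factor
    \<open>inverse (2 * u v)\<close> from the path raises the power \<open>2 * n\<close> to
    \<open>2 * n + 1\<close>.\<close>
  define G where "G = (\<lambda>v. exp (z^2) * g (u v))"
  define G' where "G' = (\<lambda>v. - (exp (- complex_of_real v) * ((-1)^n * P n / u v ^ (2 * n + 1))))"
  have Gd: "(G has_vector_derivative G' v) (at v)" for v
  proof -
    have "((g \<circ> u) has_vector_derivative (inverse (2 * u v)) * (- 2 * exp (- (u v^2)) * ((-1)^n * P n / u v ^ (2 * n)))) (at v)"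
      by (rule field_vector_diff_chain_at[OF ud gd[OF unz]])
    from has_vector_derivative_mult_right[OF this, of "exp (z^2)"]
    have "(G has_vector_derivative exp (z^2) * (inverse (2 * u v) * (- 2 * exp (- (u v^2)) * ((-1)^n * P n / u v ^ (2 * n))))) (at v)"
      by (simp add: G_def o_def)
    also have "exp (z^2) * (inverse (2 * u v) * (- 2 * exp (- (u v^2)) * ((-1)^n * P n / u v ^ (2 * n)))) = 
      - ((exp (z^2) * exp (- (u v^2))) * ((-1)^n * P n / u v ^ (2 * n + 1)))"
      using unz[of v] by (simp add: field_simps)
    also have "exp (z^2) * exp (- (u v^2)) = exp (- complex_of_real v)"
      unfolding exp_add[symmetric] u2 z2 by simp
    finally show ?thesis by (simp add: G'_def)
  qed
  define B where "B = P' n / a ^ (2 * n + 1)"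
  have P'0: "P' r \<ge> 0" for r using PP[of r] norm_ge_zero[of "P r"] by simp
  have B0: "B \<ge> 0" unfolding B_def using a P'0 by simp
  have G'b: "cmod (G' v) \<le> B * exp (- v)" for v
  proof -
    have "cmod (G' v) = exp (- v) * (P' n / cmod (u v) ^ (2 * n + 1))"
      by (simp add: G'_def norm_mult norm_divide norm_power PP)
    also have "\<dots> \<le> exp (- v) * (P' n / a ^ (2 * n + 1))"
      using a un[of v] P'0[of n] unz[of v] by (intro mult_left_mono divide_left_mono power_mono mult_pos_pos zero_less_power) auto
    finally show ?thesis by (simp add: B_def mult_ac)
  qed
  \<comment> \<open>The majorant \<open>- B * exp (- v)\<close> has derivative
    \<open>B * exp (- v)\<close> and total increase at most \<open>B\<close>, which is the claimed
    error bound. Below, \<open>G v\<close> is shown to tend to 0, so only \<open>B\<close> remains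
    in the limit.\<close>
  have GV: "cmod (G 0) \<le> B + cmod (G v)" if v: "v > 0" for v
  proof -
    have "cmod (G v - G 0) \<le> (- B * exp (- v)) - (- B * exp (- 0))"
    proof (rule differentiable_bound_general[OF v])
      show "continuous_on {0..v} G"
        using Gd by (meson continuous_at_imp_continuous_on has_vector_derivative_continuous)
      show "continuous_on {0..v} (\<lambda>v. - B * exp (- v))" by (intro continuous_intros)
      show "(G has_vector_derivative G' x) (at x)" for x by (rule Gd)
      show "((\<lambda>v. - B * exp (- v)) has_vector_derivative B * exp (- x)) (at x)" for x
        unfolding has_real_derivative_iff_has_vector_derivative[symmetric]
        by (auto intro!: derivative_eq_intros)
      show "cmod (G' x) \<le> B * exp (- x)" for x by (rule G'b)
    qed
    also have "\<dots> \<le> B" using B0 by simp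
    finally show ?thesis
      using norm_triangle_sub[of "G 0" "G v"] by (simp add: norm_minus_commute)
  qed
  have "((\<lambda>v. exp (z^2) * (complex_of_real (sqrt pi) * erfc (u v))) \<longlongrightarrow> exp (z^2) * (complex_of_real (sqrt pi) * 0)) at_top"
    unfolding u_def by (intro tendsto_intros erfc_csqrt_tendsto_0)
  moreover have "((\<lambda>v. exp (z^2) * (exp (- (u v^2)) * Q n (u v))) \<longlongrightarrow> 0) at_top"
  proof (rule Lim_null_comparison)
    define D where "D = (\<Sum>r<n. P' r / a ^ (2 * r + 1))"
    have "cmod (exp (z^2) * (exp (- (u v^2)) * Q n (u v))) \<le> exp (- v) * D" for v
    proof -
      have "cmod (Q n (u v)) \<le> (\<Sum>r<n. cmod ((-1)^r * P r / u v ^ (2 * r + 1)))"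
        unfolding Q_def by (rule norm_sum)
      also have "\<dots> \<le> D" unfolding D_def
      proof (rule sum_mono)
        show "cmod ((-1)^r * P r / u v ^ (2 * r + 1)) \<le> P' r / a ^ (2 * r + 1)" for r
          using a un[of v] P'0[of r] unz[of v]
          by (auto simp: norm_mult norm_divide norm_power PP intro!: divide_left_mono mult_mono power_mono mult_pos_pos zero_less_power)
      qed
      finally have "cmod (Q n (u v)) \<le> D" .
      moreover have "exp (z^2) * (exp (- (u v^2)) * Q n (u v)) = exp (- complex_of_real v) * Q n (u v)"
        unfolding mult.assoc[symmetric] exp_add[symmetric] u2 z2 by simp
      moreover have "cmod (exp (- complex_of_real v) * Q n (u v)) = exp (- v) * cmod (Q n (u v))"
        by (simp add: norm_mult)
      ultimately show ?thesis by (simp only:) (simp add: mult_left_mono)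
    qed
    then show "\<forall>\<^sub>F v in at_top. cmod (exp (z^2) * (exp (- (u v^2)) * Q n (u v))) \<le> exp (- v) * D" by simp
    show "((\<lambda>v. exp (- v) * D) \<longlongrightarrow> 0) at_top" by real_asymp
  qed
  ultimately have "(G \<longlongrightarrow> exp (z^2) * (complex_of_real (sqrt pi) * 0) - 0) at_top"
    unfolding G_def g_def right_diff_distrib by (rule tendsto_diff)
  then have "((\<lambda>v. B + cmod (G v)) \<longlongrightarrow> B + cmod 0) at_top" by (intro tendsto_intros) simp
  then have "cmod (G 0) \<le> B + cmod 0"
    by (rule tendsto_lowerbound) (use GV in \<open>auto intro: eventually_mono[OF eventually_gt_at_top[of 0]]\<close>)
  moreover have "G 0 = complex_of_real (sqrt pi) * exp (z^2) * erfc z - Q n z"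
    unfolding G_def g_def u0 by (simp add: ring_distribs exp_minus mult_ac)
  ultimately show ?thesis by (simp add: Q_def B_def P_def P'_def)
qed

subsection \<open>Series of scaled error functions\<close>

text \<open>For \<open>x > 0\<close> the prefactor is \<open>exp (z^2)\<close> with \<open>z\<close>
  the argument of \<open>erfc\<close>. This is the scaling under which the asymptotic series
  consists of pure powers of \<open>t\<close>.\<close>

definition scaled_erfc :: "real \<Rightarrow> real \<Rightarrow> complex" where
  "scaled_erfc x t = exp (- (pi * \<i> * t^2 / x)) * erfc (exp (- (pi * \<i> / 4)) * t * sqrt (pi / x))"

lemma exp_pi_i_4_power2: "exp (complex_of_real pi * \<i> / 4) ^ 2 = \<i>"
proof -
  have "exp (complex_of_real pi * \<i> / 4) ^ 2 = exp (\<i> * of_real (pi/2))"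
    by (simp add: exp_double[symmetric] mult_ac)
  also have "\<dots> = \<i>" unfolding exp_Euler cos_of_real sin_of_real by simp
  finally show ?thesis .
qed

lemma scaled_erfc_minus:
  "scaled_erfc x (- t) = 2 * exp (- (pi * \<i> * t^2 / x)) - scaled_erfc x t"
proof -
  define Z where "Z = exp (- (pi * \<i> / 4)) * t * sqrt (pi / x)"
  have "exp (- (pi * \<i> / 4)) * complex_of_real (- t) * sqrt (pi / x) = - Z" by (simp add: Z_def)
  then show ?thesis
    unfolding scaled_erfc_def by (simp only: erfc_minus flip: Z_def) (simp add: algebra_simps)
qed

text \<open>For \<open>n = 0\<close> this is the decay estimate \<open>\<bar>c E(t)\<bar> \<le> 1 / (2\<pi>t)\<close>.\<close>

lemma scaled_erfc_expansion:
  fixes x t :: real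
  assumes x: "x > 0" and t: "t > 0"
  defines "c \<equiv> exp (pi * \<i> / 4) / (2 * sqrt x)"
  shows "cmod (c * scaled_erfc x t - \<i> / (2 * pi) * (\<Sum>r<n. pochhammer (1/2) r * (x / (pi * \<i>)) ^ r / t ^ (2 * r + 1)))
     \<le> pochhammer (1/2) n / (2 * pi) * (x / pi) ^ n / t ^ (2 * n + 1)"
proof -
  define \<omega> where "\<omega> = exp (complex_of_real pi * \<i> / 4)"
  have w2: "\<omega>^2 = \<i>" unfolding \<omega>_def by (rule exp_pi_i_4_power2)
  have w0: "\<omega> \<noteq> 0" by (simp add: \<omega>_def)
  have iw: "exp (- (complex_of_real pi * \<i> / 4)) = inverse \<omega>" by (simp add: \<omega>_def exp_minus)
  define s where "s = sqrt (pi / x)"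
  have s: "s > 0" "s^2 = pi / x" using x by (auto simp: s_def)
  have sx: "sqrt pi = s * sqrt x" using x by (simp add: s_def real_sqrt_divide)
  have x2: "x = (sqrt x)^2" using x by simp
  define a where "a = t * s"
  have a: "a > 0" using s t by (simp add: a_def)
  define z where "z = inverse \<omega> * of_real a"
  have z0: "z \<noteq> 0" using w0 a by (simp add: z_def)
  have z2: "z^2 = - \<i> * of_real (pi * t^2 / x)"
  proof -
    have "z^2 = inverse (\<omega>^2) * of_real (a^2)"
      by (simp add: z_def power_mult_distrib power_inverse)
    then show ?thesis by (simp add: w2 a_def power_mult_distrib s(2) mult_ac)
  qed
  \<comment> \<open>The factor between \<open>c * scaled_erfc x t\<close> and the quantity in the
    \<open>erfc\<close> expansion. The leading coefficient \<open>k / z\<close> gives the prefactor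
    \<open>\<i> / (2 * pi * t)\<close>, and each further order multiplies by
    \<open>- 1 / z^2 = x / (pi * \<i> * t^2)\<close>.\<close>
  define k where "k = c / sqrt pi"
  have kz: "k / z = \<i> / (2 * pi * t)"
  proof -
    have "k / z = \<omega>^2 / (2 * (sqrt x * sqrt pi * s) * t)"
      using w0 by (simp add: k_def c_def z_def a_def \<omega>_def power2_eq_square field_simps)
    also have "sqrt x * sqrt pi * s = pi"
      using x by (simp add: s_def real_sqrt_divide)
    finally show ?thesis by (simp add: w2)
  qed
  have term_eq: "k * ((-1)^r * pochhammer (1/2) r / z ^ (2 * r + 1)) = \<i> / (2 * pi) * (pochhammer (1/2) r * (x / (pi * \<i>)) ^ r / t ^ (2 * r + 1))" for r
  proof -
    have "k * ((-1)^r * pochhammer (1/2) r / z ^ (2 * r + 1)) = (k / z) * pochhammer (1/2) r * (- 1 / z^2) ^ r"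
    proof -
      have "(- 1 / z^2) ^ r = (-1)^r / z ^ (2 * r)" by (simp only: power_divide power_mult)
      then show ?thesis by (simp only:) simp
    qed
    also have "- 1 / z^2 = x / (pi * \<i>) / t^2"
      using x t unfolding z2 by (simp add: field_simps)
    finally show ?thesis unfolding kz using t
      by (simp add: power_divide power_mult_distrib mult_ac flip: power_mult)
  qed
  have sc: "scaled_erfc x t = exp (z^2) * erfc z"
    unfolding scaled_erfc_def z2 iw by (simp add: z_def a_def s_def mult_ac)
  have "c * scaled_erfc x t - \<i> / (2 * pi) * (\<Sum>r<n. pochhammer (1/2) r * (x / (pi * \<i>)) ^ r / t ^ (2 * r + 1))
     = k * (complex_of_real (sqrt pi) * exp (z^2) * erfc z - (\<Sum>r<n. (-1)^r * pochhammer (1/2) r / z ^ (2 * r + 1)))"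
    unfolding right_diff_distrib sum_distrib_left term_eq sc by (simp add: k_def)
  also have "cmod \<dots> = cmod k * cmod (complex_of_real (sqrt pi) * exp (z^2) * erfc z - (\<Sum>r<n. (-1)^r * pochhammer (1/2) r / z ^ (2 * r + 1)))"
    by (rule norm_mult)
  also have "\<dots> \<le> cmod k * (pochhammer (1/2) n / a ^ (2 * n + 1))"
    by (intro mult_left_mono erfc_asymptotic_expansion a) (simp_all add: z_def iw)
  also have "cmod k = 1 / (2 * sqrt x * sqrt pi)"
    using x by (simp add: k_def c_def norm_divide norm_mult)
  also have "1 / (2 * sqrt x * sqrt pi) * (pochhammer (1/2) n / a ^ (2 * n + 1)) = 
      pochhammer (1/2) n / (2 * (sqrt x * sqrt pi * s)) * (1 / s^2) ^ n / t ^ (2 * n + 1)"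
    by (simp add: a_def power_mult_distrib power_mult power_divide)
  also have "sqrt x * sqrt pi * s = pi"
    using x by (simp add: s_def real_sqrt_divide)
  also have "1 / s^2 = x / pi" by (simp add: s)
  finally show ?thesis .
qed

text \<open>The expansion with no terms bounds the function by a multiple of \<open>1 / t\<close>.
  Any real offset \<open>b\<close> is allowed, since the argument is eventually positive.\<close>

lemma scaled_erfc_tendsto_0:
  assumes x: "x > 0"
  shows "(\<lambda>L. scaled_erfc x (real L + b)) \<longlonglongrightarrow> 0"
proof -
  define c where "c = exp (pi * \<i> / 4) / (2 * sqrt x)"
  have c0: "c \<noteq> 0" using x by (simp add: c_def)
  have "(\<lambda>L. c * scaled_erfc x (real L + b)) \<longlonglongrightarrow> 0"
  proof (rule Lim_null_comparison)
    have "\<forall>\<^sub>F L in sequentially. real L > - b" 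
      by (rule eventually_gt_at_top[THEN eventually_compose_filterlim, OF filterlim_real_sequentially])
    then show "\<forall>\<^sub>F L in sequentially. cmod (c * scaled_erfc x (real L + b)) \<le> 1 / (2 * pi) / (real L + b)"
    proof eventually_elim
      case (elim L)
      then show ?case using scaled_erfc_expansion[OF x, of "real L + b" 0] by (simp add: c_def)
    qed
    show "(\<lambda>L. 1 / (2 * pi) / (real L + b)) \<longlonglongrightarrow> 0" by real_asymp
  qed
  from tendsto_mult_left[OF this, of "1 / c"] show ?thesis using c0 by simp
qed

section \<open>Series for the Hurwitz zeta combinations\<close>

lemma hurwitz_zeta_odd_sums:
  fixes a :: real
  assumes "a > - 1" "r \<ge> 1"
  shows "(\<lambda>j. 1 / (real j + 1 + a) ^ (2 * r + 1)) sums hurwitz_zeta (2 * real r + 1) (1 + a)"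
proof -
  have "summable (\<lambda>j. inverse ((1 + a + real j) ^ (2 * r + 1)))"
    by (rule Polygamma_converges') (use assms in auto)
  moreover have "inverse ((1 + a + real j) ^ (2 * r + 1)) = 1 / (real j + 1 + a) ^ (2 * r + 1)" for j
    by (simp add: inverse_eq_divide add_ac)
  moreover have "(real j + (1 + a)) powr (- (2 * real r + 1)) = 1 / (real j + 1 + a) ^ (2 * r + 1)" for j
  proof -
    have "(real j + (1 + a)) powr (- (2 * real r + 1)) = inverse ((real j + (1 + a)) powr real (2 * r + 1))"
      unfolding powr_minus by (simp add: add_ac)
    also have "(real j + (1 + a)) powr real (2 * r + 1) = (real j + (1 + a)) ^ (2 * r + 1)"
      using assms by (intro powr_realpow) auto
    finally show ?thesis by (simp only: inverse_eq_divide add.assoc)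
  qed
  ultimately show ?thesis unfolding hurwitz_zeta_def by (simp add: summable_sums)
qed

text \<open>At \<open>r = 0\<close> the two halves diverge separately, but their difference is the
  cotangent series (all terms vanish if \<open>a = 0\<close>). The case split in
  \<open>Delta_minus\<close> thus gives one series formula for every \<open>r\<close>.\<close>

lemma Delta_minus_sums:
  assumes "\<bar>a\<bar> < 1"
  shows "(\<lambda>j. 1 / (real j + 1 + a) ^ (2 * r + 1) - 1 / (real j + 1 - a) ^ (2 * r + 1)) sums Delta_minus r a"
proof (cases "r = 0")
  case True
  then show ?thesis using cot_partial_fractions[OF assms] by (cases "a = 0") (auto simp: Delta_minus_def)
next
  case False
  then show ?thesis using assms
    sums_diff[OF hurwitz_zeta_odd_sums[of a r] hurwitz_zeta_odd_sums[of "- a" r]]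
    by (simp add: Delta_minus_def)
qed

lemma Delta_plus_sums:
  assumes "\<bar>a\<bar> < 1" "r \<ge> 1"
  shows "(\<lambda>j. 1 / (real j + 1 + a) ^ (2 * r + 1) + 1 / (real j + 1 - a) ^ (2 * r + 1)) sums Delta_plus r a"
  using sums_add[OF hurwitz_zeta_odd_sums[of a r] hurwitz_zeta_odd_sums[of "- a" r]] assms
  by (simp add: Delta_plus_def)

text \<open>The expansion is subtracted at \<open>j + 1 + a\<close> and \<open>j + 1 - a\<close> and
  summed over \<open>j\<close>. In the main terms the differences of powers add up to
  \<open>Delta_minus\<close>; in the errors absolute values are added, which gives
  \<open>Delta_plus\<close>. With \<open>n \<ge> 1\<close> the exponents in the errors are at least
  3, so that series converges.\<close>

lemma scaled_erfc_series:
  fixes x a :: real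
  assumes x: "x > 0" and a: "\<bar>a\<bar> < 1" and n: "n \<ge> 1"
  defines "c \<equiv> exp (pi * \<i> / 4) / (2 * sqrt x)"
  obtains d where
    "(\<lambda>j. c * (scaled_erfc x (real j + 1 + a) - scaled_erfc x (real j + 1 - a))) sums
       (\<i> / (2 * pi) * (\<Sum>r<n. pochhammer (1/2) r * (x / (pi * \<i>)) ^ r * Delta_minus r a) + d)"
    "cmod d \<le> pochhammer (1/2) n / (2 * pi) * (x / pi) ^ n * Delta_plus n a"
proof -
  define \<beta> where "\<beta> = pochhammer (1/2) n / (2 * pi) * (x / pi) ^ n"
  define P where "P = (\<lambda>t::real. \<i> / (2 * pi) * (\<Sum>r<n. pochhammer (1/2) r * (x / (pi * \<i>)) ^ r * of_real (1 / t ^ (2 * r + 1))))"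
  have expn: "cmod (c * scaled_erfc x t - P t) \<le> \<beta> / t ^ (2 * n + 1)" if "t > 0" for t
    using scaled_erfc_expansion[OF x that, of n] by (simp add: P_def c_def \<beta>_def)
  \<comment> \<open>The difference of the two truncation errors for one \<open>j\<close>; its sum is
    the witness \<open>d\<close>.\<close>
  define \<delta> where "\<delta> = (\<lambda>j. (c * scaled_erfc x (real j + 1 + a) - P (real j + 1 + a)) - (c * scaled_erfc x (real j + 1 - a) - P (real j + 1 - a)))"
  define b where "b = (\<lambda>j. \<beta> * (1 / (real j + 1 + a) ^ (2 * n + 1) + 1 / (real j + 1 - a) ^ (2 * n + 1)))"
  have db: "cmod (\<delta> j) \<le> b j" for j
  proof -
    have "cmod (\<delta> j) \<le> cmod (c * scaled_erfc x (real j + 1 + a) - P (real j + 1 + a)) + cmod (c * scaled_erfc x (real j + 1 - a) - P (real j + 1 - a))"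
      unfolding \<delta>_def by (rule norm_triangle_ineq4)
    also have "\<dots> \<le> \<beta> / (real j + 1 + a) ^ (2 * n + 1) + \<beta> / (real j + 1 - a) ^ (2 * n + 1)"
      using a by (intro add_mono expn) auto
    finally show ?thesis by (simp add: b_def distrib_left)
  qed
  have bs: "b sums (\<beta> * Delta_plus n a)"
    unfolding b_def by (intro sums_mult Delta_plus_sums a n)
  have sd: "summable (\<lambda>j. cmod (\<delta> j))"
    by (rule summable_comparison_test'[OF sums_summable[OF bs]]) (use db in auto)
  then have d: "\<delta> sums suminf \<delta>" by (rule summable_sums[OF summable_norm_cancel])
  have "cmod (suminf \<delta>) \<le> (\<Sum>j. cmod (\<delta> j))" by (rule summable_norm[OF sd])
  also have "\<dots> \<le> suminf b" by (intro suminf_le db sd sums_summable[OF bs])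
  also have "\<dots> = \<beta> * Delta_plus n a" using bs by (rule sums_unique[symmetric])
  finally have dn: "cmod (suminf \<delta>) \<le> \<beta> * Delta_plus n a" .
  have "(\<lambda>j. \<i> / (2 * pi) * (\<Sum>r<n. pochhammer (1/2) r * (x / (pi * \<i>)) ^ r *
      of_real (1 / (real j + 1 + a) ^ (2 * r + 1) - 1 / (real j + 1 - a) ^ (2 * r + 1)))) sums
      (\<i> / (2 * pi) * (\<Sum>r<n. pochhammer (1/2) r * (x / (pi * \<i>)) ^ r * of_real (Delta_minus r a)))"
    by (intro sums_mult sums_sum sums_of_real Delta_minus_sums a)
  moreover have "\<i> / (2 * pi) * (\<Sum>r<n. pochhammer (1/2) r * (x / (pi * \<i>)) ^ r *
      of_real (1 / (real j + 1 + a) ^ (2 * r + 1) - 1 / (real j + 1 - a) ^ (2 * r + 1))) = P (real j + 1 + a) - P (real j + 1 - a)" for j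
    unfolding P_def by (simp only: of_real_diff right_diff_distrib sum_subtractf)
  ultimately have "(\<lambda>j. P (real j + 1 + a) - P (real j + 1 - a)) sums
      (\<i> / (2 * pi) * (\<Sum>r<n. pochhammer (1/2) r * (x / (pi * \<i>)) ^ r * of_real (Delta_minus r a)))"
    by (simp only:)
  note sums_add[OF this d]
  moreover have "P (real j + 1 + a) - P (real j + 1 - a) + \<delta> j = c * (scaled_erfc x (real j + 1 + a) - scaled_erfc x (real j + 1 - a))" for j
    unfolding \<delta>_def by (simp only: right_diff_distrib) simp
  ultimately show thesis
    by (intro that[of "suminf \<delta>"]) (use dn in \<open>simp_all only: \<beta>_def\<close>)
qed

subsection \<open>Gauss sums\<close>

text \<open>The endpoint theorem is applied to the translate of \<open>F\<close> to each interval
  \<open>{j..j+1}\<close>. The exponentials have period 1, so all coefficients with index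
  \<open>k\<close> are increments of one antiderivative, and summing over \<open>j\<close>
  telescopes.\<close>

lemma quadratic_phase_Fourier_sum:
  fixes x \<theta> :: real and f :: "real \<Rightarrow> complex"
  assumes x: "x > 0"
    and f: "\<And>t. f t = exp (pi * \<i> * x * t^2 + 2 * pi * \<i> * \<theta> * t)"
  defines "c \<equiv> exp (pi * \<i> / 4) / (2 * sqrt x)"
  shows "(\<lambda>K. \<Sum>k=-int K..int K. c * (scaled_erfc x (\<theta> - of_int k) - f N * scaled_erfc x (real N * x + \<theta> - of_int k)))
    \<longlonglongrightarrow> (\<Sum>j=1..N. f (real j)) - (f N - 1) / 2"
proof -
  define F where "F = (\<lambda>z::complex. exp (pi * \<i> * x * z^2 + 2 * pi * \<i> * \<theta> * z))"
  have Ff: "F (of_real t) = f t" for t by (simp add: F_def f)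
  define \<omega> where "\<omega> = exp (complex_of_real pi * \<i> / 4)"
  have w2: "\<omega>^2 = \<i>" unfolding \<omega>_def by (rule exp_pi_i_4_power2)
  have w0: "\<omega> \<noteq> 0" by (simp add: \<omega>_def)
  have iw: "exp (- (complex_of_real pi * \<i> / 4)) = inverse \<omega>" by (simp add: \<omega>_def exp_minus)
  define W where "W = inverse \<omega> * sqrt (pi / x)"
  have W2: "W^2 = - \<i> * pi / x"
  proof -
    have "W^2 = inverse (\<omega>^2) * of_real (sqrt (pi / x) ^ 2)"
      by (simp add: W_def power_mult_distrib power_inverse)
    then show ?thesis using x by (simp add: w2)
  qed
  \<comment> \<open>The constant \<open>c\<close> is exactly what normalises the chain-rule factor
    of the antiderivative to 1.\<close>
  have cW: "c * (2 / sqrt pi) * W * x = 1"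
  proof -
    have "c * (2 / sqrt pi) * W * x = of_real (sqrt (pi / x) * x / (sqrt x * sqrt pi))"
      using w0 by (simp add: c_def W_def \<omega>_def)
    also have "sqrt (pi / x) * x / (sqrt x * sqrt pi) = 1"
      using x by (simp add: real_sqrt_divide)
    finally show ?thesis by simp
  qed
  \<comment> \<open>Completing the square: \<open>x * z^2 + 2 * (\<theta> - k) * z\<close> equals
    \<open>((x * z + \<theta> - k)^2 - (\<theta> - k)^2) / x\<close>. The first square becomes the
    Gaussian behind \<open>erfc\<close>, the second the constant factor in front.\<close>
  define \<Phi> where "\<Phi> = (\<lambda>(k::int) z. - (c * exp (- (pi * \<i> * (\<theta> - of_int k)^2 / x)) * erfc (W * (of_real x * z + of_real (\<theta> - of_int k)))))"
  have \<Phi>d: "(\<Phi> k has_field_derivative F z * exp (- (2 * pi * \<i> * of_int k * z))) (at z within A)" for k z A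
  proof -
    let ?u = "W * (of_real x * z + of_real (\<theta> - of_int k))"
    let ?e = "exp (- (pi * \<i> * (\<theta> - of_int k)^2 / x))"
    have "((\<lambda>z. W * (of_real x * z + of_real (\<theta> - of_int k))) has_field_derivative W * x) (at z within A)"
      by (auto intro!: derivative_eq_intros)
    from DERIV_chain2[OF erfc_has_field_derivative this]
    have "((\<lambda>z. erfc (W * (of_real x * z + of_real (\<theta> - of_int k)))) has_field_derivative
      - 2 / complex_of_real (sqrt pi) * exp (- (?u^2)) * (W * x)) (at z within A)" .
    from DERIV_minus[OF DERIV_cmult[OF this, of "c * ?e"]]
    have "(\<Phi> k has_field_derivative (c * (2 / sqrt pi) * W * x) * (?e * exp (- (?u^2)))) (at z within A)"
      by (simp add: \<Phi>_def mult_ac)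
    also have "?e * exp (- (?u^2)) = F z * exp (- (2 * pi * \<i> * of_int k * z))"
      unfolding F_def exp_add[symmetric] power_mult_distrib W2
      using x by (intro arg_cong[where f = exp]) (simp add: field_simps power2_eq_square)
    finally show ?thesis unfolding cW by simp
  qed
  have unit: "integral {0..1} (\<lambda>t. F (of_real t + of_nat j) * exp (- (2 * pi * \<i> * of_int k * of_real t))) = \<Phi> k (of_nat (Suc j)) - \<Phi> k (of_nat j)" for j k
  proof (rule integral_unique)
    have "((\<lambda>z. \<Phi> k (z + of_nat j)) has_field_derivative F (z + of_nat j) * exp (- (2 * pi * \<i> * of_int k * (z + of_nat j)))) (at z within A)" for z A
    proof -
      have "((\<lambda>z. z + of_nat j) has_field_derivative 1) (at z within A)"
        by (auto intro!: derivative_eq_intros)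
      from DERIV_chain2[where f = "\<Phi> k" and g = "\<lambda>z. z + of_nat j", OF \<Phi>d this]
      show ?thesis by simp
    qed
    moreover have "exp (- (2 * pi * \<i> * of_int k * (z + of_nat j))) = exp (- (2 * pi * \<i> * of_int k * z))" for z
    proof -
      have "- (2 * pi * \<i> * of_int k * (z + of_nat j)) = - (2 * pi * \<i> * of_int k * z) + 2 * of_int (- k * int j) * pi * \<i>"
        by (simp add: algebra_simps)
      then show ?thesis
        using exp_integer_2pi[of "of_int (- k * int j)"] by (simp only: exp_add) simp
    qed
    ultimately have "((\<lambda>z. \<Phi> k (z + of_nat j)) has_field_derivative F (z + of_nat j) * exp (- (2 * pi * \<i> * of_int k * z))) (at z within A)" for z A
      by simp
    then have "((\<lambda>t. F (of_real t + of_nat j) * exp (- (2 * pi * \<i> * of_int k * of_real t))) has_integral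
        (\<Phi> k (of_real 1 + of_nat j) - \<Phi> k (of_real 0 + of_nat j))) {0..1}"
      by (intro fundamental_theorem_of_calculus has_vector_derivative_real_field) auto
    then show "((\<lambda>t. F (of_real t + of_nat j) * exp (- (2 * pi * \<i> * of_int k * of_real t))) has_integral
        (\<Phi> k (of_nat (Suc j)) - \<Phi> k (of_nat j))) {0..1}" by simp
  qed
  have lim1: "(\<lambda>K. \<Sum>k=-int K..int K. \<Phi> k (of_nat (Suc j)) - \<Phi> k (of_nat j)) \<longlonglongrightarrow> (f (real j) + f (real (Suc j))) / 2" for j
  proof -
    have "(\<lambda>z. F (z + of_nat j)) holomorphic_on UNIV" unfolding F_def by (intro holomorphic_intros)
    from Fourier_series_endpoint[OF this] show ?thesis
      unfolding unit using Ff[of "real j"] Ff[of "real (Suc j)"] by (simp add: add_ac)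
  qed
  have "(\<lambda>K. \<Sum>j<N. \<Sum>k=-int K..int K. \<Phi> k (of_nat (Suc j)) - \<Phi> k (of_nat j)) \<longlonglongrightarrow> (\<Sum>j<N. (f (real j) + f (real (Suc j))) / 2)"
    by (intro tendsto_sum lim1)
  moreover have "(\<Sum>j<N. \<Sum>k=-int K..int K. \<Phi> k (of_nat (Suc j)) - \<Phi> k (of_nat j)) =
     (\<Sum>k=-int K..int K. c * (scaled_erfc x (\<theta> - of_int k) - f N * scaled_erfc x (real N * x + \<theta> - of_int k)))" for K
  proof -
    have "(\<Sum>j<N. \<Sum>k=-int K..int K. \<Phi> k (of_nat (Suc j)) - \<Phi> k (of_nat j)) =
      (\<Sum>k=-int K..int K. \<Phi> k (of_nat N) - \<Phi> k 0)"
      using sum_lessThan_telescope[where f = "\<lambda>i. \<Phi> k (of_nat i)" for k]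
      by (subst sum.swap) (simp del: of_nat_Suc)
    also have "\<dots> = (\<Sum>k=-int K..int K. c * (scaled_erfc x (\<theta> - of_int k) - f N * scaled_erfc x (real N * x + \<theta> - of_int k)))"
    proof (rule sum.cong[OF refl])
      fix k :: int
      have "\<Phi> k 0 = - (c * scaled_erfc x (\<theta> - of_int k))"
        unfolding \<Phi>_def scaled_erfc_def iw by (simp add: W_def mult_ac)
      \<comment> \<open>At the upper end \<open>z = N\<close> the constant must carry the square of
        \<open>N * x + \<theta> - k\<close> to form a \<open>scaled_erfc\<close>. The change costs
        the factor \<open>f N\<close>, because
        \<open>exp (2 * pi * \<i> * N * k) = 1\<close>.\<close>
      moreover have "exp (- (pi * \<i> * (\<theta> - of_int k)^2 / x)) = f N * exp (- (pi * \<i> * (real N * x + \<theta> - of_int k)^2 / x))"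
      proof -
        have "exp (- (2 * pi * \<i> * of_nat N * of_int k)) = 1"
          using exp_integer_2pi[of "of_int (- k * int N)"] by (simp add: algebra_simps)
        then have "f N = f N * exp (- (2 * pi * \<i> * of_nat N * of_int k))" by simp
        then have "f N * exp (- (pi * \<i> * (real N * x + \<theta> - of_int k)^2 / x)) = 
             f N * exp (- (2 * pi * \<i> * of_nat N * of_int k)) * exp (- (pi * \<i> * (real N * x + \<theta> - of_int k)^2 / x))"
          by simp
        also have "\<dots> = exp (- (pi * \<i> * (\<theta> - of_int k)^2 / x))"
          unfolding f exp_add[symmetric]
          using x by (intro arg_cong[where f = exp]) (simp add: field_simps power2_eq_square)
        finally show ?thesis by simp
      qed
      then have "\<Phi> k (of_nat N) = - (c * f N * scaled_erfc x (real N * x + \<theta> - of_int k))"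
        unfolding \<Phi>_def scaled_erfc_def iw by (simp add: W_def mult_ac add_diff_eq)
      ultimately show "\<Phi> k (of_nat N) - \<Phi> k 0 = c * (scaled_erfc x (\<theta> - of_int k) - f N * scaled_erfc x (real N * x + \<theta> - of_int k))"
        by (simp add: algebra_simps)
    qed
    finally show ?thesis .
  qed
  \<comment> \<open>The trapezoidal sum counts \<open>f 0 = 1\<close> and \<open>f N\<close> by
    half, hence the correction.\<close>
  moreover have "(\<Sum>j<N. (f (real j) + f (real (Suc j))) / 2) = (\<Sum>j=1..N. f (real j)) - (f N - 1) / 2"
  proof (induction N)
    case 0
    then show ?case by (simp add: f)
  next
    case (Suc N)
    then show ?case by (simp del: of_nat_Suc) (simp add: field_simps del: of_nat_Suc)
  qed
  ultimately show ?thesis by simp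
qed

text \<open>Only the terms \<open>k = j + 1\<close> are reflected, at the cost of one Gaussian each.
  If \<open>a\<close> has modulus below 1, every argument in the resulting series is positive; the
  term \<open>k = 0\<close> is kept apart.\<close>

lemma sum_scaled_erfc_symmetric:
  "(\<Sum>k=-int L..int L. c * scaled_erfc x (a - of_int k))
   = c * scaled_erfc x a + (\<Sum>j<L. c * (scaled_erfc x (real j + 1 + a) - scaled_erfc x (real j + 1 - a)))
     + 2 * c * (\<Sum>j<L. exp (- (pi * \<i> * (real j + 1 - a)^2 / x)))"
proof -
  have "c * scaled_erfc x (a - of_int (int j + 1)) + c * scaled_erfc x (a - of_int (- (int j + 1)))
      = c * (scaled_erfc x (real j + 1 + a) - scaled_erfc x (real j + 1 - a)) + 2 * c * exp (- (pi * \<i> * (real j + 1 - a)^2 / x))" for j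
  proof -
    have "a - of_int (int j + 1) = - (real j + 1 - a)" "a - of_int (- (int j + 1)) = real j + 1 + a"
      by simp_all
    then show ?thesis by (simp only: scaled_erfc_minus) (simp add: algebra_simps)
  qed
  then have "(\<Sum>k=-int L..int L. c * scaled_erfc x (a - of_int k)) = c * scaled_erfc x (a - of_int 0) +
      (\<Sum>j<L. c * (scaled_erfc x (real j + 1 + a) - scaled_erfc x (real j + 1 - a)) + 2 * c * exp (- (pi * \<i> * (real j + 1 - a)^2 / x)))"
    by (simp only: sum_symmetric_interval)
  then show ?thesis by (simp only: sum.distrib sum_distrib_left of_int_0 diff_zero add.assoc)
qed

text \<open>A window symmetric about 0 is not symmetric about \<open>m\<close>. With half-width
  \<open>L + m\<close>, the shift leaves the window of half-width \<open>L\<close> and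
  \<open>2 * m\<close> surplus terms, all at its lower end.\<close>

lemma sum_shifted_symmetric_interval:
  fixes h :: "int \<Rightarrow> 'a :: ab_group_add"
  shows "(\<Sum>k=-int (L + m)..int (L + m). h (k - int m)) = (\<Sum>k=-int L..int L. h k) + (\<Sum>i<2*m. h (- (int L + 1 + int i)))"
proof -
  have "(\<Sum>k=-int (L + m)..int (L + m). h (k - int m)) = (\<Sum>k=-int L - int (2*m)..int L. h k)"
    by (rule sum.reindex_bij_witness[of _ "\<lambda>k. k + int m" "\<lambda>k. k - int m"]) auto
  also have "\<dots> = (\<Sum>k=-int L..int L. h k) + (\<Sum>i<2*m. h (- (int L + 1 + int i)))"
  proof -
    have "(\<Sum>k=-int L - int j..int L. h k) = (\<Sum>k=-int L..int L. h k) + (\<Sum>i<j. h (- (int L + 1 + int i)))" for j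
    proof (induction j)
      case (Suc j)
      have "{- int L - int (Suc j)..int L} = insert (- (int L + 1 + int j)) {-int L - int j..int L}"
        by auto
      then show ?case using Suc by (simp add: algebra_simps)
    qed simp
    then show ?thesis .
  qed
  finally show ?thesis .
qed

lemma sum_lessThan_add:
  fixes h :: "nat \<Rightarrow> 'a :: comm_monoid_add"
  shows "(\<Sum>j<L + m. h j) = (\<Sum>j<m. h j) + (\<Sum>j<L. h (j + m))"
  by (induction L) (simp_all add: add_ac)

theorem theorem1:
  fixes x \<theta> \<xi> \<epsilon> :: real and N n :: nat and M :: int
    and f E :: "real \<Rightarrow> complex" and C :: "nat \<Rightarrow> complex"
  assumes x: "0 < x" "x < 1"
    and theta: "- 1/2 \<le> \<theta>" "\<theta> \<le> 1/2"
    and N: "N \<ge> 1"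
    and f: "\<And>t. f t = exp (pi * \<i> * x * t^2 + 2 * pi * \<i> * \<theta> * t)"
    and xi: "\<xi> = real N * x + \<theta>"
    and eps: "\<epsilon> = \<xi> - real_of_int M" "- 1/2 < \<epsilon>" "\<epsilon> \<le> 1/2"
    and M: "M \<ge> 0"
    and n: "n \<ge> 1"
    and E: "\<And>t. E t = exp (- (pi * \<i> * t^2 / x)) * erfc (exp (- (pi * \<i> / 4)) * t * sqrt (pi / x))"
    and C: "\<And>r. C r = f N * Delta_minus r \<epsilon> - Delta_minus r \<theta>"
  shows "\<exists>R :: complex.
     gauss_sum N x \<theta>
       - exp (- (pi * \<i> * \<theta>^2 / x) + pi * \<i> / 4) / sqrt x * gauss_sum (nat M) (- 1 / x) (\<theta> / x)
       - 1/2 * (f N - 1)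
       - exp (pi * \<i> / 4) / (2 * sqrt x) * (E \<theta> - f N * E \<epsilon>)
     = 1 / (2 * pi * \<i>) * (\<Sum>r<n. Gamma (real r + 1/2) / Gamma (1/2 :: real) * (x / (pi * \<i>)) ^ r * C r) + R
     \<and> cmod R \<le> pochhammer (1/2) n / (2 * pi) * (x / pi) ^ n * (Delta_plus n \<epsilon> + Delta_plus n \<theta>)"
proof -
  define c where "c = exp (pi * \<i> / 4) / (2 * sqrt x)"
  define m where "m = nat M"
  have Mm: "M = int m" using M by (simp add: m_def)
  have xe: "real N * x + \<theta> = \<epsilon> + real m" using eps(1) xi Mm by simp
  have Es: "E = scaled_erfc x" by (simp add: fun_eq_iff E scaled_erfc_def)
  have fN: "cmod (f N) = 1" by (simp add: f)
  have at: "\<bar>\<theta>\<bar> < 1" "\<bar>\<epsilon>\<bar> < 1" using theta eps by auto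
  define A where "A = (\<lambda>a L. \<Sum>j<L. c * (scaled_erfc x (real j + 1 + a) - scaled_erfc x (real j + 1 - a)))"
  define D where "D = (\<lambda>a. \<i> / (2 * pi) * (\<Sum>r<n. pochhammer (1/2) r * (x / (pi * \<i>)) ^ r * Delta_minus r a))"
  obtain d\<^sub>\<theta> where d\<theta>: "A \<theta> \<longlonglongrightarrow> D \<theta> + d\<^sub>\<theta>"
    "cmod d\<^sub>\<theta> \<le> pochhammer (1/2) n / (2 * pi) * (x / pi) ^ n * Delta_plus n \<theta>"
    using scaled_erfc_series[OF x(1) at(1) n] unfolding sums_def A_def c_def D_def by blast
  obtain d\<^sub>\<epsilon> where d\<epsilon>: "A \<epsilon> \<longlonglongrightarrow> D \<epsilon> + d\<^sub>\<epsilon>"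
    "cmod d\<^sub>\<epsilon> \<le> pochhammer (1/2) n / (2 * pi) * (x / pi) ^ n * Delta_plus n \<epsilon>"
    using scaled_erfc_series[OF x(1) at(2) n] unfolding sums_def A_def c_def D_def by blast
  define e where "e = (\<lambda>j. exp (- (pi * \<i> * (real j + 1 - \<theta>)^2 / x)))"
  \<comment> \<open>Since \<open>\<epsilon> - (j + 1) = \<xi> - (j + m + 1)\<close>, the Gaussians
    from reflecting the \<open>\<epsilon>\<close> series are, after multiplication by
    \<open>f N\<close>, those of the \<open>\<theta>\<close> series from index \<open>m\<close> on.
    The reason is again that \<open>N\<close> times an integer is a whole number of periods.\<close>
  have shift: "f N * exp (- (pi * \<i> * (real j + 1 - \<epsilon>)^2 / x)) = e (j + m)" for j
  proof -
    \<comment> \<open>Eliminating \<open>N\<close> in favour of \<open>\<epsilon>\<close>,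
      \<open>m\<close> and \<open>\<theta>\<close> turns the comparison of exponents into a rational
      identity.\<close>
    have N': "of_nat N = (of_real \<epsilon> + of_nat m - of_real \<theta>) / complex_of_real x"
    proof -
      have "real N = (\<epsilon> + real m - \<theta>) / x" using xe x(1) by (simp add: field_simps)
      then have "complex_of_real (real N) = of_real ((\<epsilon> + real m - \<theta>) / x)" by (rule arg_cong)
      then show ?thesis by simp
    qed
    have per: "exp (- (2 * pi * \<i> * of_nat N * of_nat (j + m + 1))) = 1"
      using exp_integer_2pi[of "of_int (- (int (j + m + 1) * int N))"] by (simp add: algebra_simps)
    have "f N * exp (- (pi * \<i> * (real j + 1 - \<epsilon>)^2 / x)) = 
       f N * exp (- (2 * pi * \<i> * of_nat N * of_nat (j + m + 1))) * exp (- (pi * \<i> * (real j + 1 - \<epsilon>)^2 / x))"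
      unfolding per by simp
    also have "\<dots> = e (j + m)"
      unfolding f e_def exp_add[symmetric]
      using x(1) by (intro arg_cong[where f = exp]) (simp add: N' field_simps power2_eq_square)
    finally show ?thesis .
  qed
  \<comment> \<open>The surplus terms of the shifted window. Their number \<open>2 * m\<close> is
    fixed while each argument grows with \<open>L\<close>, so they vanish in the limit.\<close>
  define err where "err = (\<lambda>L. f N * c * (\<Sum>i<2*m. scaled_erfc x (real L + (\<epsilon> + 1 + real i))))"
  \<comment> \<open>The \<open>\<theta>\<close> series is cut at \<open>L + m\<close> and the
    \<open>\<epsilon>\<close> series at \<open>L\<close>, so the Gaussians \<open>e j\<close> with
    \<open>j \<ge> m\<close> cancel before any limit is taken. Those with \<open>j < m\<close>
    remain.\<close>
  have partial: "(\<Sum>k=-int (L + m)..int (L + m). c * (scaled_erfc x (\<theta> - of_int k) - f N * scaled_erfc x (real N * x + \<theta> - of_int k)))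
     = c * (E \<theta> - f N * E \<epsilon>) + 2 * c * (\<Sum>j<m. e j) + A \<theta> (L + m) - f N * A \<epsilon> L - err L" for L
  proof -
    have "(\<Sum>k=-int (L + m)..int (L + m). c * scaled_erfc x (real N * x + \<theta> - of_int k))
        = (\<Sum>k=-int (L + m)..int (L + m). c * scaled_erfc x (\<epsilon> - of_int (k - int m)))"
      unfolding xe by (simp add: algebra_simps)
    also have "\<dots> = (\<Sum>k=-int L..int L. c * scaled_erfc x (\<epsilon> - of_int k)) +
        (\<Sum>i<2*m. c * scaled_erfc x (\<epsilon> - of_int (- (int L + 1 + int i))))"
      by (rule sum_shifted_symmetric_interval)
    finally have "f N * (\<Sum>k=-int (L + m)..int (L + m). c * scaled_erfc x (real N * x + \<theta> - of_int k))
      = f N * (\<Sum>k=-int L..int L. c * scaled_erfc x (\<epsilon> - of_int k)) +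
        f N * (\<Sum>i<2*m. c * scaled_erfc x (\<epsilon> - of_int (- (int L + 1 + int i))))"
      by (simp only: distrib_left)
    also have "f N * (\<Sum>i<2*m. c * scaled_erfc x (\<epsilon> - of_int (- (int L + 1 + int i)))) = err L"
      by (simp add: err_def sum_distrib_left algebra_simps)
    finally have 1: "f N * (\<Sum>k=-int (L + m)..int (L + m). c * scaled_erfc x (real N * x + \<theta> - of_int k))
      = f N * (\<Sum>k=-int L..int L. c * scaled_erfc x (\<epsilon> - of_int k)) + err L" .
    have 2: "(\<Sum>k=-int L..int L. c * scaled_erfc x (\<epsilon> - of_int k)) = 
       c * E \<epsilon> + A \<epsilon> L + 2 * c * (\<Sum>j<L. exp (- (pi * \<i> * (real j + 1 - \<epsilon>)^2 / x)))"
      unfolding sum_scaled_erfc_symmetric A_def Es ..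
    have 3: "(\<Sum>k=-int (L + m)..int (L + m). c * scaled_erfc x (\<theta> - of_int k)) =
       c * E \<theta> + A \<theta> (L + m) + 2 * c * (\<Sum>j<L + m. e j)"
      unfolding sum_scaled_erfc_symmetric A_def Es e_def ..
    have 4: "f N * (2 * c * (\<Sum>j<L. exp (- (pi * \<i> * (real j + 1 - \<epsilon>)^2 / x)))) = 2 * c * (\<Sum>j<L. e (j + m))"
      unfolding shift[symmetric] sum_distrib_left by (simp add: mult_ac)
    have "(\<Sum>k=-int (L + m)..int (L + m). c * (scaled_erfc x (\<theta> - of_int k) - f N * scaled_erfc x (real N * x + \<theta> - of_int k)))
      = (\<Sum>k=-int (L + m)..int (L + m). c * scaled_erfc x (\<theta> - of_int k))
       - f N * (\<Sum>k=-int (L + m)..int (L + m). c * scaled_erfc x (real N * x + \<theta> - of_int k))"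
      by (simp add: sum_distrib_left right_diff_distrib sum_subtractf mult.left_commute[of "f N"])
    also have "\<dots> = c * (E \<theta> - f N * E \<epsilon>) + 2 * c * (\<Sum>j<m. e j) + A \<theta> (L + m) - f N * A \<epsilon> L - err L"
      unfolding 1 2 3 sum_lessThan_add distrib_left 4 by (simp add: algebra_simps)
    finally show ?thesis .
  qed
  have lim1: "(\<lambda>L. c * (E \<theta> - f N * E \<epsilon>) + 2 * c * (\<Sum>j<m. e j) + A \<theta> (L + m) - f N * A \<epsilon> L - err L)
      \<longlonglongrightarrow> (\<Sum>j=1..N. f (real j)) - (f N - 1) / 2"
    using LIMSEQ_ignore_initial_segment[OF quadratic_phase_Fourier_sum[OF x(1) f, of N], of m]
    unfolding c_def[symmetric] partial .
  have "err \<longlonglongrightarrow> f N * c * (\<Sum>i<2*m. 0)"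
    unfolding err_def by (intro tendsto_intros scaled_erfc_tendsto_0 x)
  then have err: "err \<longlonglongrightarrow> 0" by simp
  have "(\<lambda>L. c * (E \<theta> - f N * E \<epsilon>) + 2 * c * (\<Sum>j<m. e j) + A \<theta> (L + m) - f N * A \<epsilon> L - err L)
     \<longlonglongrightarrow> c * (E \<theta> - f N * E \<epsilon>) + 2 * c * (\<Sum>j<m. e j) + (D \<theta> + d\<^sub>\<theta>) - f N * (D \<epsilon> + d\<^sub>\<epsilon>) - 0"
    using LIMSEQ_ignore_initial_segment[OF d\<theta>(1), of m] d\<epsilon>(1) err by (intro tendsto_intros) simp_all
  from LIMSEQ_unique[OF lim1 this]
  have key: "(\<Sum>j=1..N. f (real j)) - (f N - 1) / 2 = 
     c * (E \<theta> - f N * E \<epsilon>) + 2 * c * (\<Sum>j<m. e j) + (D \<theta> + d\<^sub>\<theta>) - f N * (D \<epsilon> + d\<^sub>\<epsilon>)"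
    by simp
  have gN: "gauss_sum N x \<theta> = (\<Sum>j=1..N. f (real j))"
    unfolding gauss_sum_def f by (simp add: mult_ac)
  \<comment> \<open>The prefactor \<open>exp (- (pi * \<i> * \<theta>^2 / x))\<close> completes the
    square in each summand, giving \<open>(j + 1 - \<theta>)^2\<close> after the index shift to
    \<open>j < m\<close>; the other factor is \<open>2 * c\<close>.\<close>
  have gm: "exp (- (pi * \<i> * \<theta>^2 / x) + pi * \<i> / 4) / sqrt x * gauss_sum m (- 1 / x) (\<theta> / x) = 2 * c * (\<Sum>j<m. e j)"
  proof -
    have "exp (- (pi * \<i> * \<theta>^2 / x)) * gauss_sum m (- 1 / x) (\<theta> / x) = (\<Sum>j<m. e j)"
    proof -
      have "gauss_sum m (- 1 / x) (\<theta> / x) = (\<Sum>j<m. exp (pi * \<i> * (- 1 / x) * (of_nat (Suc j))^2 + 2 * pi * \<i> * of_nat (Suc j) * (\<theta> / x)))"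
        unfolding gauss_sum_def by (simp add: sum.atLeast1_atMost_eq del: of_nat_Suc)
      also have "exp (- (pi * \<i> * \<theta>^2 / x)) * \<dots> = (\<Sum>j<m. e j)"
        unfolding sum_distrib_left
      proof (rule sum.cong[OF refl])
        show "exp (- (pi * \<i> * \<theta>^2 / x)) * exp (pi * \<i> * (- 1 / x) * (of_nat (Suc j))^2 + 2 * pi * \<i> * of_nat (Suc j) * (\<theta> / x)) = e j" for j
          unfolding e_def exp_add[symmetric]
          using x(1) by (intro arg_cong[where f = exp]) (simp add: field_simps power2_eq_square)
      qed
      finally show ?thesis .
    qed
    then show ?thesis unfolding exp_add by (simp add: c_def mult_ac)
  qed
  have DC: "1 / (2 * pi * \<i>) * (\<Sum>r<n. Gamma (real r + 1/2) / Gamma (1/2 :: real) * (x / (pi * \<i>)) ^ r * C r)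
     = D \<theta> - f N * D \<epsilon>"
  proof -
    have g: "complex_of_real (Gamma (real r + 1/2) / Gamma (1/2)) = pochhammer (1/2) r" for r
    proof -
      have "(1/2 :: real) \<notin> \<int>\<^sub>\<le>\<^sub>0" by (auto elim!: nonpos_Ints_cases)
      from pochhammer_Gamma[OF this, of r] have "Gamma (real r + 1/2) / Gamma (1/2) = pochhammer (1/2 :: real) r"
        by (simp add: add_ac)
      then show ?thesis by (simp add: pochhammer_of_real[symmetric])
    qed
    \<comment> \<open>This sign accounts for the order in \<open>C\<close>, where
      \<open>\<epsilon>\<close> comes before \<open>\<theta>\<close>, opposite to
      \<open>D \<theta> - f N * D \<epsilon>\<close>.\<close>
    have i: "1 / (2 * pi * \<i>) = - (\<i> / (2 * pi))" by (simp add: field_simps)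
    define \<kappa> where "\<kappa> = (\<lambda>r. pochhammer (1/2 :: complex) r * (x / (pi * \<i>)) ^ r)"
    have "(\<Sum>r<n. Gamma (real r + 1/2) / Gamma (1/2 :: real) * (x / (pi * \<i>)) ^ r * C r) = (\<Sum>r<n. \<kappa> r * C r)"
      unfolding g[symmetric] \<kappa>_def by simp
    also have "\<dots> = f N * (\<Sum>r<n. \<kappa> r * Delta_minus r \<epsilon>) - (\<Sum>r<n. \<kappa> r * Delta_minus r \<theta>)"
      by (simp add: C right_diff_distrib sum_subtractf sum_distrib_left mult_ac)
    finally have s: "(\<Sum>r<n. Gamma (real r + 1/2) / Gamma (1/2 :: real) * (x / (pi * \<i>)) ^ r * C r)
       = f N * (\<Sum>r<n. \<kappa> r * Delta_minus r \<epsilon>) - (\<Sum>r<n. \<kappa> r * Delta_minus r \<theta>)" .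
    have D: "D a = \<i> / (2 * pi) * (\<Sum>r<n. \<kappa> r * Delta_minus r a)" for a
      by (simp add: D_def \<kappa>_def pochhammer_of_real[symmetric])
    show ?thesis unfolding i s D by (simp add: algebra_simps)
  qed
  show ?thesis
  \<comment> \<open>The remainder is \<open>d\<^sub>\<theta> - f N * d\<^sub>\<epsilon>\<close>. As
    \<open>f N\<close> has modulus 1, the two error bounds simply add.\<close>
  proof (intro exI conjI)
    show "gauss_sum N x \<theta>
       - exp (- (pi * \<i> * \<theta>^2 / x) + pi * \<i> / 4) / sqrt x * gauss_sum (nat M) (- 1 / x) (\<theta> / x)
       - 1/2 * (f N - 1)
       - exp (pi * \<i> / 4) / (2 * sqrt x) * (E \<theta> - f N * E \<epsilon>)
     = 1 / (2 * pi * \<i>) * (\<Sum>r<n. Gamma (real r + 1/2) / Gamma (1/2 :: real) * (x / (pi * \<i>)) ^ r * C r) + (d\<^sub>\<theta> - f N * d\<^sub>\<epsilon>)"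
      unfolding DC gN m_def[symmetric] gm c_def[symmetric] using key by (simp add: algebra_simps)
    have "cmod (d\<^sub>\<theta> - f N * d\<^sub>\<epsilon>) \<le> cmod d\<^sub>\<theta> + cmod d\<^sub>\<epsilon>"
      using norm_triangle_ineq4[of "d\<^sub>\<theta>" "f N * d\<^sub>\<epsilon>"] by (simp add: norm_mult fN)
    also have "\<dots> \<le> pochhammer (1/2) n / (2 * pi) * (x / pi) ^ n * (Delta_plus n \<epsilon> + Delta_plus n \<theta>)"
      using add_mono[OF d\<theta>(2) d\<epsilon>(2)] by (simp add: distrib_left)
    finally show "cmod (d\<^sub>\<theta> - f N * d\<^sub>\<epsilon>) \<le> pochhammer (1/2) n / (2 * pi) * (x / pi) ^ n * (Delta_plus n \<epsilon> + Delta_plus n \<theta>)" .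
  qed
qed

end
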